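(* Let $d\ge2$ and let $H_n$ be the number of distinct $d$-ary trees (shapes with child positions retained, labels removed) occurring among the fringe subtrees of a random $d$-ary increasing tree of size $n$. With $$\underline{c}(d)=\frac{d}{d-1}\log(d-1)+d^2\sum_{k\ge1}\frac{\log k}{((d-1)k+d)((d-1)k+1)},\qquad \overline{c}(d)=\frac{d}{d-1}\big(d\log d-(d-1)\log(d-1)\big),$$ (i) $\frac{\underline{c}(d)n}{\log n}(1+o(1))\le\mathbb{E}(H_n)\le\frac{\overline{c}(d)n}{\log n}(1+o(1))$; (ii) with probability tending to $1$, $\frac{\underline{c}(d)n}{\log n}(1+o(1))\le H_n\le\frac{\overline{c}(d)n}{\log n}(1+o(1))$.
   Context: A $d$-ary increasing tree of size $n$ is a $d$-ary tree (each vertex has $d$ distinct positions for children) with vertices labelled $1,\dots,n$ increasingly along paths from the root; a random one is chosen uniformly. A fringe subtree is a vertex with all descendants. *)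

theory Defs
  imports "HOL-Probability.Probability"
begin

(* The list in a node holds its child positions from left to right; a vacant position is Empty. *)
datatype 'a dtree = Empty | Node 'a "'a dtree list"

fun dary :: "nat \<Rightarrow> 'a dtree \<Rightarrow> bool" where
  "dary d Empty \<longleftrightarrow> True"
| "dary d (Node a ts) \<longleftrightarrow> length ts = d \<and> (\<forall>t\<in>set ts. dary d t)"

fun labels :: "'a dtree \<Rightarrow> 'a list" where
  "labels Empty = []"
| "labels (Node a ts) = a # concat (map labels ts)"

fun increasing :: "nat dtree \<Rightarrow> bool" where
  "increasing Empty \<longleftrightarrow> True"
| "increasing (Node a ts) \<longleftrightarrow> (\<forall>t\<in>set ts. (\<forall>b\<in>set (labels t). a < b) \<and> increasing t)"

definition dary_increasing_trees :: "nat \<Rightarrow> nat \<Rightarrow> nat dtree set" where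
  "dary_increasing_trees d n =
     {t. dary d t \<and> increasing t \<and> distinct (labels t) \<and> set (labels t) = {1..n}}"

definition random_tree :: "nat \<Rightarrow> nat \<Rightarrow> nat dtree pmf" where
  "random_tree d n = pmf_of_set (dary_increasing_trees d n)"

(* Only vertices root a fringe subtree, so the empty tree is never one. *)
fun fringe_subtrees :: "'a dtree \<Rightarrow> 'a dtree set" where
  "fringe_subtrees Empty = {}"
| "fringe_subtrees (Node a ts) = insert (Node a ts) (\<Union>t\<in>set ts. fringe_subtrees t)"

definition shape :: "'a dtree \<Rightarrow> unit dtree" where
  "shape = map_dtree (\<lambda>_. ())"

definition num_distinct_fringe :: "'a dtree \<Rightarrow> nat" where
  "num_distinct_fringe t = card (shape ` fringe_subtrees t)"

definition c_lower :: "nat \<Rightarrow> real" where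
  "c_lower d = real d / (real d - 1) * ln (real d - 1) +
     (real d)\<^sup>2 * (\<Sum>\<^sub>\<infinity>k\<in>{1::nat..}.
        ln (real k) / (((real d - 1) * real k + real d) * ((real d - 1) * real k + 1)))"

definition c_upper :: "nat \<Rightarrow> real" where
  "c_upper d = real d / (real d - 1) * (real d * ln (real d) - (real d - 1) * ln (real d - 1))"

(* The uniform distribution pmf_of_set is specified only for finite nonempty sets. *)

lemma finite_dary_bounded:
  assumes "finite A"
  shows "finite {t. dary d t \<and> set (labels t) \<subseteq> A \<and> length (labels t) \<le> k}"
    (is "finite (?S k)")
proof (induction k)
  case 0
  have "?S 0 \<subseteq> {Empty}"
  proof
    fix t assume "t \<in> ?S 0"
    then show "t \<in> {Empty}" by (cases t) auto
  qed
  then show ?case by (rule finite_subset) simp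
next
  case (Suc k)
  let ?L = "{ts. set ts \<subseteq> ?S k \<and> length ts = d}"
  have "?S (Suc k) \<subseteq> insert Empty ((\<lambda>(a, ts). Node a ts) ` (A \<times> ?L))"
  proof
    fix t assume t: "t \<in> ?S (Suc k)"
    show "t \<in> insert Empty ((\<lambda>(a, ts). Node a ts) ` (A \<times> ?L))"
    proof (cases t)
      case Empty
      then show ?thesis by simp
    next
      case (Node a ts)
      have "length (labels s) \<le> k" if "s \<in> set ts" for s
      proof -
        have "length (labels s) \<le> sum_list (map (length \<circ> labels) ts)"
          using that by (intro member_le_sum_list) auto
        also have "\<dots> \<le> k"
          using t Node by (simp add: length_concat)
        finally show ?thesis .
      qed
      then have "ts \<in> ?L" "a \<in> A"
        using t Node by auto
      then show ?thesis using Node by auto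
    qed
  qed
  moreover have "finite ?L"
    using Suc.IH by (rule finite_lists_length_eq)
  ultimately show ?case
    using assms by (meson finite_SigmaI finite_imageI finite_insert finite_subset)
qed

lemma finite_dary_increasing_trees: "finite (dary_increasing_trees d n)"
proof (rule finite_subset)
  show "dary_increasing_trees d n \<subseteq>
      {t. dary d t \<and> set (labels t) \<subseteq> {1..n} \<and> length (labels t) \<le> n}"
    by (auto simp: dary_increasing_trees_def simp flip: distinct_card)
  show "finite \<dots>"
    by (rule finite_dary_bounded) simp
qed

lemma dary_increasing_trees_nonempty:
  assumes "d \<ge> 1"
  shows "dary_increasing_trees d n \<noteq> {}"
proof -
  have "\<exists>t. dary d t \<and> increasing t \<and> distinct (labels t) \<and> set (labels t) = {Suc m..m + n}" for m
  proof (induction n arbitrary: m)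
    case 0
    show ?case by (rule exI[of _ Empty]) simp
  next
    case (Suc n)
    obtain t where t: "dary d t" "increasing t" "distinct (labels t)"
        "set (labels t) = {Suc (Suc m)..Suc m + n}"
      using Suc[of "Suc m"] by blast
    let ?t = "Node (Suc m) (t # replicate (d - 1) Empty)"
    have *: "concat (map labels (replicate k Empty)) = []" for k
      by (induction k) auto
    have "dary d ?t \<and> increasing ?t \<and> distinct (labels ?t) \<and> set (labels ?t) = {Suc m..m + Suc n}"
      using t assms * by auto
    then show ?case by blast
  qed
  from this[of 0] show ?thesis
    by (auto simp: dary_increasing_trees_def)
qed

end

theory Submission
  imports Defs "HOL-Real_Asymp.Real_Asymp"
begin

text \<open>
  A random increasing tree of size \<open>n + 1\<close> arises from one of size \<open>n\<close> by inserting a leaf at a uniform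
  vacant position. The number \<open>Z\<close> of fringe subtrees of size at least \<open>k\<close> grows by at most 1 per
  insertion, and so has variance at most \<open>n\<close>; its mean is about \<open>d n / ((d - 1) k)\<close>.

  Upper bound: there are \<open>O(exp (L k))\<close> shapes of size below \<open>k\<close>, where
  \<open>L = d log d - (d - 1) log (d - 1)\<close>, and at most \<open>Z\<close> shapes of size at least \<open>k\<close> occur. Take \<open>k\<close>
  slightly below \<open>log n / L\<close>.

  Lower bound: by the hook length formula, a shape of size \<open>k\<close> has probability
  \<open>exp (- k log (d - 1) - S + O(log k))\<close>, where \<open>S\<close> is the sum of \<open>log |T|\<close> over the fringe subtrees \<open>T\<close>. The weak
  law for the numbers \<open>Z\<close> with bounded \<open>k\<close> shows that this is at most \<open>exp (- \<mu> k)\<close> outside an event of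
  probability \<open>O(1 / sqrt k)\<close>, for every \<open>\<mu> < (d - 1) / d * c_lower d\<close>. Disjoint fringe subtrees are
  independent given their sizes, so for \<open>k\<close> slightly above \<open>log n / \<mu>\<close> the expected number of coincidences
  among the typical fringe subtrees of size at least \<open>k\<close> is at most
  \<open>n\<^sup>2 exp (- \<mu> k) = o(n / log n)\<close>, and almost all of the \<open>Z\<close> subtrees are distinct.
\<close>

section \<open>Growth of increasing trees\<close>

fun tree_size :: "'a dtree \<Rightarrow> nat" where
  "tree_size Empty = 0"
| "tree_size (Node a ts) = Suc (\<Sum>t\<leftarrow>ts. tree_size t)"

text \<open>The lists have one entry per vacant position, so averaging over
  \<open>grow d x t\<close> is insertion of a leaf at a uniform vacant position. The polymorphic
  label serves both labelled trees and, with \<open>()\<close>, shapes.\<close>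

fun grow :: "nat \<Rightarrow> 'a \<Rightarrow> 'a dtree \<Rightarrow> 'a dtree list"
  and grows :: "nat \<Rightarrow> 'a \<Rightarrow> 'a dtree list \<Rightarrow> 'a dtree list list" where
  "grow d x Empty = [Node x (replicate d Empty)]"
| "grow d x (Node a ts) = map (Node a) (grows d x ts)"
| "grows d x [] = []"
| "grows d x (t # ts) = map (\<lambda>s. s # ts) (grow d x t) @ map (Cons t) (grows d x ts)"

text \<open>The inverse of \<open>grow\<close>: for the largest label of an increasing tree, the
  subtree cut off is a single leaf.\<close>

fun delete_label :: "'a \<Rightarrow> 'a dtree \<Rightarrow> 'a dtree" where
  "delete_label x Empty = Empty"
| "delete_label x (Node a ts) = (if a = x then Empty else Node a (map (delete_label x) ts))"

lemma concat_labels_replicate_Empty [simp]: "concat (map labels (replicate n Empty)) = []"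
  by (induction n) auto

lemma tree_size_labels: "tree_size t = length (labels t)"
proof (induction t)
  case (Node a ts)
  then show ?case by (simp add: length_concat o_def cong: map_cong)
qed simp

lemma grow_dary:
  "dary d t \<Longrightarrow> s \<in> set (grow d x t) \<Longrightarrow> dary d s \<and> tree_size s = Suc (tree_size t)"
  "(\<forall>t\<in>set ts. dary d t) \<Longrightarrow> ss \<in> set (grows d x ts) \<Longrightarrow>
     length ss = length ts \<and> (\<forall>s\<in>set ss. dary d s) \<and>
     (\<Sum>s\<leftarrow>ss. tree_size s) = Suc (\<Sum>t\<leftarrow>ts. tree_size t)"
proof (induction d x t and d x ts arbitrary: s and ss rule: grow_grows.induct)
qed (force simp: sum_list_replicate)+

text \<open>A tree with \<open>m\<close> vertices has \<open>d * m + 1\<close> positions including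
  that of the root, and \<open>m\<close> of them are occupied. The additive form avoids truncated
  subtraction.\<close>

lemma length_grow:
  "dary d t \<Longrightarrow> length (grow d x t) + tree_size t = d * tree_size t + 1"
  "\<forall>t\<in>set ts. dary d t \<Longrightarrow>
     length (grows d x ts) + (\<Sum>t\<leftarrow>ts. tree_size t) = d * (\<Sum>t\<leftarrow>ts. tree_size t) + length ts"
proof (induction d x t and d x ts rule: grow_grows.induct)
qed (auto simp: algebra_simps)

lemma map_grow:
  "map (map_dtree f) (grow d x t) = grow d (f x) (map_dtree f t)"
  "map (map (map_dtree f)) (grows d x ts) = grows d (f x) (map (map_dtree f) ts)"
proof (induction d x t and d x ts rule: grow_grows.induct)
  case (2 d x a ts)
  have "map (map_dtree f) (grow d x (Node a ts)) = map (Node (f a)) (map (map (map_dtree f)) (grows d x ts))"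
    by simp
  then show ?case by (simp only: 2) simp
next
  case (4 d x t ts)
  have "map (map (map_dtree f)) (grows d x (t # ts)) =
     map (\<lambda>s. s # map (map_dtree f) ts) (map (map_dtree f) (grow d x t)) @
     map (Cons (map_dtree f t)) (map (map (map_dtree f)) (grows d x ts))"
    by simp
  then show ?case by (simp only: 4) simp
qed (auto simp: map_replicate_const)

lemma labels_grow:
  "s \<in> set (grow d x t) \<Longrightarrow> set (labels s) = insert x (set (labels t))"
  "ss \<in> set (grows d x ts) \<Longrightarrow>
     set (concat (map labels ss)) = insert x (set (concat (map labels ts)))"
proof (induction d x t and d x ts arbitrary: s and ss rule: grow_grows.induct)
  case (1 d x)
  then show ?case by (simp del: set_concat)
next
  case (2 d x a ts)
  then show ?case by auto
next
  case (4 d x t ts)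
  from 4(3) consider s where "s \<in> set (grow d x t)" "ss = s # ts"
    | rs where "rs \<in> set (grows d x ts)" "ss = t # rs" by auto
  then show ?case
  proof cases
    case 1
    then show ?thesis using 4(1)[of s] by simp
  next
    case 2
    then show ?thesis using 4(2)[of rs] by auto
  qed
qed simp

lemma increasing_grow:
  "s \<in> set (grow d x t) \<Longrightarrow> increasing t \<Longrightarrow> \<forall>b\<in>set (labels t). b < x \<Longrightarrow> increasing s"
  "ss \<in> set (grows d x ts) \<Longrightarrow> \<forall>t\<in>set ts. increasing t \<Longrightarrow>
     \<forall>b\<in>set (concat (map labels ts)). b < x \<Longrightarrow> \<forall>s\<in>set ss. increasing s"
proof (induction d x t and d x ts arbitrary: s and ss rule: grow_grows.induct)
  case (2 d x a ts)
  then obtain ss where ss: "ss \<in> set (grows d x ts)" "s = Node a ss" by auto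
  have "\<forall>s\<in>set ss. increasing s" using 2 ss by auto
  moreover have "set (concat (map labels ss)) = insert x (set (concat (map labels ts)))"
    using labels_grow(2)[OF ss(1)] .
  then have "\<forall>s\<in>set ss. \<forall>b\<in>set (labels s). a < b"
    using 2(3,4) by auto
  ultimately show ?case using ss by simp
qed auto

lemma delete_label_fresh: "x \<notin> set (labels t) \<Longrightarrow> delete_label x t = t"
  by (induction t) (auto intro!: map_idI)

lemma delete_label_grow:
  "s \<in> set (grow d x t) \<Longrightarrow> x \<notin> set (labels t) \<Longrightarrow> delete_label x s = t"
  "ss \<in> set (grows d x ts) \<Longrightarrow> x \<notin> set (concat (map labels ts)) \<Longrightarrow> map (delete_label x) ss = ts"
proof (induction d x t and d x ts arbitrary: s and ss rule: grow_grows.induct)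
qed (auto simp: delete_label_fresh intro!: map_idI)

lemma distinct_grow:
  "x \<notin> set (labels t) \<Longrightarrow> distinct (grow d x t)"
  "x \<notin> set (concat (map labels ts)) \<Longrightarrow> distinct (grows d x ts)"
proof (induction d x t and d x ts rule: grow_grows.induct)
  case (4 d x t ts)
  have "t \<notin> set (grow d x t)"
    using labels_grow(1)[of t d x t] 4(3) by auto
  then show ?case using 4 by (auto simp: distinct_map inj_on_def)
qed (auto simp: distinct_map inj_on_def)

lemma labels_distinct_grow:
  "s \<in> set (grow d x t) \<Longrightarrow> distinct (labels t) \<Longrightarrow> x \<notin> set (labels t) \<Longrightarrow> distinct (labels s)"
  "ss \<in> set (grows d x ts) \<Longrightarrow> distinct (concat (map labels ts)) \<Longrightarrow>
     x \<notin> set (concat (map labels ts)) \<Longrightarrow> distinct (concat (map labels ss))"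
proof (induction d x t and d x ts arbitrary: s and ss rule: grow_grows.induct)
  case (1 d x)
  then show ?case by (simp del: set_concat)
next
  case (2 d x a ts)
  then obtain ss where ss: "ss \<in> set (grows d x ts)" "s = Node a ss" by auto
  then show ?case using 2 labels_grow(2)[OF ss(1)] by (auto simp del: set_concat)
next
  case (4 d x t ts)
  from 4(3) consider s where "s \<in> set (grow d x t)" "ss = s # ts"
    | rs where "rs \<in> set (grows d x ts)" "ss = t # rs" by auto
  then show ?case
  proof cases
    case 1
    then show ?thesis using 4(1)[of s] 4(4,5) labels_grow(1)[OF 1(1)]
      by (auto simp del: set_concat)
  next
    case 2
    then show ?thesis using 4(2)[of rs] 4(4,5) labels_grow(2)[OF 2(1)]
      by (auto simp del: set_concat)
  qed
qed simp

lemma labels_eq_Nil_iff [simp]: "labels t = [] \<longleftrightarrow> t = Empty"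
  by (cases t) auto

lemma delete_label_props:
  "dary d t \<Longrightarrow> dary d (delete_label x t)"
  "set (labels (delete_label x t)) \<subseteq> set (labels t)"
  "increasing t \<Longrightarrow> increasing (delete_label x t)"
proof -
  show *: "set (labels (delete_label x t)) \<subseteq> set (labels t)" for t
    by (induction t) auto
  show "dary d t \<Longrightarrow> dary d (delete_label x t)" by (induction t) auto
  show "increasing t \<Longrightarrow> increasing (delete_label x t)"
    by (induction t) (use * in fastforce)+
qed

text \<open>Nothing lies below the largest label of an increasing tree, and distinctness puts this
  label into only one child at each node on the way, so the deletion removes one leaf, which
  \<open>grow\<close> restores.\<close>

lemma grow_delete_label:
  "dary d t \<Longrightarrow> increasing t \<Longrightarrow> distinct (labels t) \<Longrightarrow> x \<in> set (labels t) \<Longrightarrow>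
   \<forall>b\<in>set (labels t). b \<le> x \<Longrightarrow> t \<in> set (grow d x (delete_label x t))"
proof (induction t)
  case (Node a ts)
  show ?case
  proof (cases "a = x")
    case True
    have "t = Empty" if "t \<in> set ts" for t
    proof -
      have "labels t = []"
        using Node.prems(2,5) that True by (cases "labels t") force+
      then show ?thesis by simp
    qed
    then have "ts = replicate d Empty"
      using Node.prems(1) by (auto intro!: replicate_eqI)
    then show ?thesis using True by simp
  next
    case False
    have "us \<in> set (grows d x (map (delete_label x) us))"
      if "set us \<subseteq> set ts" "distinct (concat (map labels us))" "x \<in> set (concat (map labels us))" for us
      using that
    proof (induction us)
      case (Cons u us)
      show ?case
      proof (cases "x \<in> set (labels u)")
        case True
        have "u \<in> set (grow d x (delete_label x u))"
          using Node.IH[of u] Node.prems True Cons.prems by auto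
        moreover have "map (delete_label x) us = us"
          using True Cons.prems by (auto intro!: map_idI delete_label_fresh)
        ultimately show ?thesis by simp
      next
        case False
        then show ?thesis using Cons by (simp add: delete_label_fresh)
      qed
    qed simp
    from this[of ts] show ?thesis using Node.prems False by auto
  qed
qed simp

lemma dary_increasing_trees_Suc:
  "dary_increasing_trees d (Suc n) =
     (\<Union>t\<in>dary_increasing_trees d n. set (grow d (Suc n) t))"
proof (intro equalityI subsetI)
  fix t assume t: "t \<in> dary_increasing_trees d (Suc n)"
  let ?r = "delete_label (Suc n) t"
  from t have mem: "t \<in> set (grow d (Suc n) ?r)"
    by (intro grow_delete_label) (auto simp: dary_increasing_trees_def)
  have "x \<notin> set (labels (delete_label x u))" for x and u :: "nat dtree"
    by (induction u) auto
  then have fresh: "Suc n \<notin> set (labels ?r)" .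
  have "insert (Suc n) (set (labels ?r)) = insert (Suc n) {1..n}"
    using labels_grow(1)[OF mem] t atLeastAtMostSuc_conv[of 1 n]
    by (simp add: dary_increasing_trees_def)
  then have "set (labels ?r) = {1..n}"
    using fresh by (simp add: insert_ident)
  moreover have dary: "dary d ?r" and "increasing ?r"
    using t delete_label_props by (auto simp: dary_increasing_trees_def)
  moreover have "length (labels t) = Suc n"
    using t by (simp add: dary_increasing_trees_def flip: distinct_card)
  then have "length (labels ?r) = n"
    using grow_dary(1)[OF dary mem] by (simp add: tree_size_labels)
  ultimately have "?r \<in> dary_increasing_trees d n"
    by (simp add: dary_increasing_trees_def card_distinct)
  then show "t \<in> (\<Union>t\<in>dary_increasing_trees d n. set (grow d (Suc n) t))"
    using mem by blast
next
  fix s assume "s \<in> (\<Union>t\<in>dary_increasing_trees d n. set (grow d (Suc n) t))"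
  then obtain t where t: "t \<in> dary_increasing_trees d n" and s: "s \<in> set (grow d (Suc n) t)" by blast
  show "s \<in> dary_increasing_trees d (Suc n)"
    using t grow_dary(1)[OF _ s] increasing_grow(1)[OF s] labels_grow(1)[OF s]
      labels_distinct_grow(1)[OF s]
    by (auto simp: dary_increasing_trees_def)
qed

text \<open>\<open>delete_label\<close> recovers the predecessor and \<open>distinct_grow\<close>
  separates the positions, so each tree of size \<open>Suc n\<close> comes from exactly one
  insertion.\<close>

lemma sum_dary_increasing_trees_Suc:
  fixes F :: "nat dtree \<Rightarrow> real"
  shows "(\<Sum>s\<in>dary_increasing_trees d (Suc n). F s) =
    (\<Sum>t\<in>dary_increasing_trees d n. \<Sum>s\<leftarrow>grow d (Suc n) t. F s)"
proof -
  have fresh: "Suc n \<notin> set (labels t)" if "t \<in> dary_increasing_trees d n" for t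
    using that by (auto simp: dary_increasing_trees_def)
  have "(\<Sum>s\<in>dary_increasing_trees d (Suc n). F s) =
    (\<Sum>t\<in>dary_increasing_trees d n. \<Sum>s\<in>set (grow d (Suc n) t). F s)"
    unfolding dary_increasing_trees_Suc
  proof (rule sum.UNION_disjoint)
    show "\<forall>t\<in>dary_increasing_trees d n. \<forall>u\<in>dary_increasing_trees d n.
        t \<noteq> u \<longrightarrow> set (grow d (Suc n) t) \<inter> set (grow d (Suc n) u) = {}"
    proof (intro ballI impI equals0I)
      fix t u s assume "t \<in> dary_increasing_trees d n" "u \<in> dary_increasing_trees d n" "t \<noteq> u"
        "s \<in> set (grow d (Suc n) t) \<inter> set (grow d (Suc n) u)"
      then show False
        using delete_label_grow(1)[of s d "Suc n" t] delete_label_grow(1)[of s d "Suc n" u] fresh by simp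
    qed
  qed (auto simp: finite_dary_increasing_trees)
  also have "\<dots> = (\<Sum>t\<in>dary_increasing_trees d n. \<Sum>s\<leftarrow>grow d (Suc n) t. F s)"
    by (intro sum.cong refl) (simp add: sum_list_distinct_conv_sum_set distinct_grow(1) fresh)
  finally show ?thesis .
qed

section \<open>Sums over fringe subtrees\<close>

text \<open>Occurrences are summed with multiplicity, one for each vertex, whereas
  \<open>fringe_subtrees\<close> forgets repetitions.\<close>

fun fringe_sum :: "('a dtree \<Rightarrow> real) \<Rightarrow> 'a dtree \<Rightarrow> real" where
  "fringe_sum f Empty = 0"
| "fringe_sum f (Node a ts) = f (Node a ts) + (\<Sum>t\<leftarrow>ts. fringe_sum f t)"

abbreviation leaf :: "nat \<Rightarrow> 'a \<Rightarrow> 'a dtree" where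
  "leaf d x \<equiv> Node x (replicate d Empty)"

text \<open>Up to the normalisation by the number of vacant positions, this is the generator of the growth
  process.\<close>

definition drift :: "nat \<Rightarrow> 'a \<Rightarrow> ('a dtree \<Rightarrow> real) \<Rightarrow> 'a dtree \<Rightarrow> real" where
  "drift d x f t = (\<Sum>s\<leftarrow>grow d x t. f s) - real (length (grow d x t)) * f t"

text \<open>For a fringe subtree \<open>u\<close>, insertions outside \<open>u\<close> leave
  \<open>f u\<close> unchanged, and those inside run through \<open>grow d x u\<close>; the excess
  over a constant contribution is \<open>drift d x f u\<close>. Every insertion also creates one new
  leaf.\<close>

lemma sum_list_grow_fringe_sum:
  "(\<Sum>s\<leftarrow>grow d x t. fringe_sum f s) =
     real (length (grow d x t)) * (fringe_sum f t + f (leaf d x)) + fringe_sum (drift d x f) t"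
  "(\<Sum>ss\<leftarrow>grows d x ts. \<Sum>s\<leftarrow>ss. fringe_sum f s) =
     real (length (grows d x ts)) * ((\<Sum>t\<leftarrow>ts. fringe_sum f t) + f (leaf d x)) +
     (\<Sum>t\<leftarrow>ts. fringe_sum (drift d x f) t)"
proof (induction d x t and d x ts rule: grow_grows.induct)
  case (2 d x a ts)
  then show ?case
    by (simp add: o_def sum_list_addf drift_def algebra_simps)
qed (auto simp: o_def sum_list_addf sum_list_triv sum_list_replicate algebra_simps)

lemma fringe_sum_mono:
  assumes "dary d t" "\<And>u. dary d u \<Longrightarrow> u \<noteq> Empty \<Longrightarrow> f u \<le> g u"
  shows "fringe_sum f t \<le> fringe_sum g t"
  using assms(1)
proof (induction t)
  case (Node a ts)
  then have "(\<Sum>t\<leftarrow>ts. fringe_sum f t) \<le> (\<Sum>t\<leftarrow>ts. fringe_sum g t)"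
    by (intro sum_list_mono) auto
  then show ?case using assms(2)[of "Node a ts"] Node.prems by auto
qed simp

lemma fringe_sum_cong:
  assumes "dary d t" "\<And>u. dary d u \<Longrightarrow> u \<noteq> Empty \<Longrightarrow> f u = g u"
  shows "fringe_sum f t = fringe_sum g t"
  using assms fringe_sum_mono[OF assms(1), of f g] fringe_sum_mono[OF assms(1), of g f] by fastforce

lemma fringe_sum_add: "fringe_sum (\<lambda>u. f u + g u) t = fringe_sum f t + fringe_sum g t"
proof (induction t)
  case (Node a ts)
  then have "(\<Sum>t\<leftarrow>ts. fringe_sum (\<lambda>u. f u + g u) t) = (\<Sum>t\<leftarrow>ts. fringe_sum f t + fringe_sum g t)"
    by (metis (no_types, lifting) map_eq_conv)
  then show ?case by (simp add: sum_list_addf)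
qed simp

lemma fringe_sum_cmult: "fringe_sum (\<lambda>u. c * f u) t = c * fringe_sum f t"
proof (induction t)
  case (Node a ts)
  then have "(\<Sum>t\<leftarrow>ts. fringe_sum (\<lambda>u. c * f u) t) = (\<Sum>t\<leftarrow>ts. c * fringe_sum f t)"
    by (metis (no_types, lifting) map_eq_conv)
  then show ?case by (simp add: sum_list_const_mult distrib_left)
qed simp

lemma fringe_sum_zero [simp]: "fringe_sum (\<lambda>u. 0) t = 0"
  using fringe_sum_cmult[of 0 "\<lambda>_. 0"] by simp

lemma fringe_sum_sum: "fringe_sum (\<lambda>u. \<Sum>i\<in>I. f i u) t = (\<Sum>i\<in>I. fringe_sum (f i) t)"
  by (induction I rule: infinite_finite_induct) (simp_all add: fringe_sum_add)

lemma real_sum_list: "real (\<Sum>t\<leftarrow>ts. f t) = (\<Sum>t\<leftarrow>ts. real (f t))"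
  by (induction ts) auto

lemma fringe_sum_one: "fringe_sum (\<lambda>u. 1) t = real (tree_size t)"
proof (induction t)
  case (Node a ts)
  then have "(\<Sum>t\<leftarrow>ts. fringe_sum (\<lambda>u. 1) t) = (\<Sum>t\<leftarrow>ts. real (tree_size t))"
    by (metis (no_types, lifting) map_eq_conv)
  then show ?case by (simp add: real_sum_list)
qed simp

lemma tree_size_eq_0_iff [simp]: "tree_size t = 0 \<longleftrightarrow> t = Empty"
  by (cases t) auto

lemma tree_size_le_sum: "t \<in> set ts \<Longrightarrow> tree_size t \<le> (\<Sum>t\<leftarrow>ts. tree_size t)"
  by (simp add: member_le_sum_list)

section \<open>The growth process on shapes and its expectation\<close>

locale dary_growth =
  fixes d :: nat
  assumes d_ge_2: "2 \<le> d"
begin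

text \<open>The number of vacant positions in a \<open>d\<close>-ary tree with \<open>k\<close>
  vertices.\<close>

definition slots :: "nat \<Rightarrow> real" where
  "slots k = (real d - 1) * real k + 1"

lemma slots_ge_1: "1 \<le> slots k"
  using d_ge_2 by (simp add: slots_def)

lemma slots_pos [simp]: "0 < slots k" and slots_nz [simp]: "slots k \<noteq> 0"
  using slots_ge_1[of k] by auto

lemma slots_mono: "j \<le> k \<Longrightarrow> slots j \<le> slots k"
  using d_ge_2 by (simp add: slots_def mult_left_mono)

lemma length_grow_slots:
  assumes "dary d t"
  shows "real (length (grow d x t)) = slots (tree_size t)"
proof -
  have "real (length (grow d x t) + tree_size t) = real (d * tree_size t + 1)"
    using length_grow(1)[OF assms] by metis
  then show ?thesis by (simp add: slots_def algebra_simps)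
qed

text \<open>\<open>mean n f\<close> is the expectation of \<open>f\<close> at the shape of a random tree of size \<open>n\<close>, which grows by
  inserting a leaf at a uniformly chosen vacant position.\<close>

fun mean :: "nat \<Rightarrow> (unit dtree \<Rightarrow> real) \<Rightarrow> real" where
  "mean 0 f = f Empty"
| "mean (Suc n) f = mean n (\<lambda>t. (\<Sum>s\<leftarrow>grow d () t. f s) / slots n)"

lemma mean_mono:
  assumes "\<And>t. dary d t \<Longrightarrow> tree_size t = n \<Longrightarrow> f t \<le> g t"
  shows "mean n f \<le> mean n g"
  using assms
proof (induction n arbitrary: f g)
  case (Suc n)
  have "(\<Sum>s\<leftarrow>grow d () t. f s) / slots n \<le> (\<Sum>s\<leftarrow>grow d () t. g s) / slots n"
    if "dary d t" "tree_size t = n" for t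
    using grow_dary(1)[OF that(1)] that Suc.prems
    by (intro divide_right_mono sum_list_mono) (auto intro: less_imp_le)
  then show ?case using Suc.IH by auto
qed simp

lemma mean_cong:
  assumes "\<And>t. dary d t \<Longrightarrow> tree_size t = n \<Longrightarrow> f t = g t"
  shows "mean n f = mean n g"
  using mean_mono[of n f g] mean_mono[of n g f] assms by fastforce

lemma mean_add: "mean n (\<lambda>t. f t + g t) = mean n f + mean n g"
  by (induction n arbitrary: f g) (simp_all add: sum_list_addf add_divide_distrib)

lemma mean_cmult: "mean n (\<lambda>t. c * f t) = c * mean n f"
  by (induction n arbitrary: f) (simp_all add: sum_list_const_mult flip: times_divide_eq_right)

lemma mean_zero [simp]: "mean n (\<lambda>t. 0) = 0"
  using mean_cmult[of n 0 "\<lambda>_. 0"] by simp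

lemma mean_diff: "mean n (\<lambda>t. f t - g t) = mean n f - mean n g"
  using mean_add[of n f "\<lambda>t. (-1) * g t"] mean_cmult[of n "-1" g] by simp

lemma mean_sum: "mean n (\<lambda>t. \<Sum>i\<in>I. f i t) = (\<Sum>i\<in>I. mean n (f i))"
  by (induction I rule: infinite_finite_induct) (simp_all add: mean_add)

lemma mean_sum_list: "mean n (\<lambda>t. \<Sum>i\<leftarrow>is. f i t) = (\<Sum>i\<leftarrow>is. mean n (f i))"
  by (induction "is") (simp_all add: mean_add)

lemma mean_const [simp]: "mean n (\<lambda>t. c) = c"
proof (induction n)
  case (Suc n)
  have "mean (Suc n) (\<lambda>t. c) = mean n (\<lambda>t. c)"
    unfolding mean.simps
    by (rule mean_cong) (simp add: sum_list_triv length_grow_slots)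
  then show ?case using Suc by simp
qed simp

lemma mean_nonneg: "(\<And>t. dary d t \<Longrightarrow> tree_size t = n \<Longrightarrow> 0 \<le> f t) \<Longrightarrow> 0 \<le> mean n f"
  using mean_mono[of n "\<lambda>_. 0" f] by simp

lemma mean_Suc_drift: "mean (Suc n) f = mean n f + mean n (drift d () f) / slots n"
proof -
  have "mean (Suc n) f = mean n (\<lambda>t. f t + (1 / slots n) * drift d () f t)"
    unfolding mean.simps
    by (rule mean_cong) (simp add: drift_def length_grow_slots field_simps)
  then show ?thesis by (simp only: mean_add mean_cmult) simp
qed

lemma mean_drift: "mean n (drift d () f) = slots n * (mean (Suc n) f - mean n f)"
  by (simp only: mean_Suc_drift) simp

lemma mean_Suc_fringe_sum:
  "mean (Suc n) (fringe_sum f) =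
     mean n (fringe_sum f) + f (leaf d ()) + mean n (fringe_sum (drift d () f)) / slots n"
proof -
  have "mean (Suc n) (fringe_sum f) =
    mean n (\<lambda>t. (fringe_sum f t + f (leaf d ())) + (1 / slots n) * fringe_sum (drift d () f) t)"
    unfolding mean.simps
    by (rule mean_cong) (simp add: sum_list_grow_fringe_sum length_grow_slots field_simps)
  then show ?thesis by (simp only: mean_add mean_cmult mean_const) simp
qed

definition avg :: "(unit dtree \<Rightarrow> real) \<Rightarrow> unit dtree \<Rightarrow> real" where
  "avg f t = mean (tree_size t) f"

lemma sum_list_grow_size:
  fixes f :: "nat \<Rightarrow> real"
  assumes "dary d t"
  shows "(\<Sum>s\<leftarrow>grow d x t. f (tree_size s)) = slots (tree_size t) * f (Suc (tree_size t))"
proof -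
  have "(\<Sum>s\<leftarrow>grow d x t. f (tree_size s)) = (\<Sum>s\<leftarrow>grow d x t. f (Suc (tree_size t)))"
    using grow_dary(1)[OF assms] by (intro arg_cong[where f = sum_list] map_cong) auto
  then show ?thesis using assms by (simp add: sum_list_triv length_grow_slots)
qed

text \<open>\<open>avg f\<close> depends on the size only, so its drift is the number of slots times
  the increment of the means; \<open>mean_drift\<close> identifies this with the mean of the
  drift.\<close>

lemma drift_avg: "dary d t \<Longrightarrow> drift d () (avg f) t = avg (drift d () f) t"
  using sum_list_grow_size[of t "\<lambda>k. mean k f"]
  by (simp add: drift_def[of d "()" "avg f"] avg_def mean_drift length_grow_slots right_diff_distrib
      del: mean.simps)

text \<open>Given its size, a fringe subtree is again a random tree. Both sides obey
  \<open>mean_Suc_fringe_sum\<close>, which replaces \<open>f\<close> by its drift; hence the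
  induction keeps \<open>f\<close> arbitrary.\<close>

lemma mean_fringe_sum_avg: "mean n (fringe_sum f) = mean n (fringe_sum (avg f))"
proof (induction n arbitrary: f)
  case (Suc n)
  have "avg f (leaf d ()) = f (leaf d ())"
    by (simp add: avg_def sum_list_replicate slots_def)
  moreover have "mean n (fringe_sum (drift d () f)) = mean n (fringe_sum (drift d () (avg f)))"
    unfolding Suc[of "drift d () f"]
    by (rule mean_cong) (auto intro!: fringe_sum_cong simp: drift_avg)
  ultimately show ?case
    by (simp only: mean_Suc_fringe_sum Suc[of f])
qed simp

section \<open>Counts of large fringe subtrees and their concentration\<close>

definition fringe_ge :: "nat \<Rightarrow> unit dtree \<Rightarrow> real" where
  "fringe_ge k = fringe_sum (\<lambda>u. of_bool (k \<le> tree_size u))"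

text \<open>The closed form of the expected count for \<open>k \<ge> 1\<close>: it equals
  \<open>n\<close> at \<open>k = 1\<close> and obeys the same recursion as the expectation.\<close>

definition mean_fringe_ge :: "nat \<Rightarrow> nat \<Rightarrow> real" where
  "mean_fringe_ge n k = (if k \<le> n then (real d * slots n / slots k - 1) / (real d - 1) else 0)"

lemma fringe_ge_eq_0: "tree_size t < k \<Longrightarrow> fringe_ge k t = 0"
proof (induction t)
  case (Node a ts)
  have "fringe_ge k t = 0" if "t \<in> set ts" for t
    using Node.IH[OF that] Node.prems tree_size_le_sum[OF that] by simp
  then have "(\<Sum>t\<leftarrow>ts. fringe_sum (\<lambda>u. of_bool (k \<le> tree_size u)) t) = 0"
    unfolding fringe_ge_def by (metis (no_types, lifting) map_eq_conv sum_list_0)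
  then show ?case using Node.prems by (simp add: fringe_ge_def)
qed (simp add: fringe_ge_def)

lemma fringe_ge_1: "fringe_ge 1 t = real (tree_size t)"
proof (induction t)
  case (Node a ts)
  then have "(\<Sum>t\<leftarrow>ts. fringe_ge 1 t) = (\<Sum>t\<leftarrow>ts. real (tree_size t))"
    by (metis (no_types, lifting) map_eq_conv)
  then show ?case by (simp add: fringe_ge_def real_sum_list)
qed (simp add: fringe_ge_def)

text \<open>Only a fringe subtree of size exactly \<open>k\<close> can newly reach size
  \<open>Suc k\<close>, and \<open>slots k\<close> insertions achieve this. Since
  \<open>1 \<le> k\<close>, the new leaf itself is not counted.\<close>

lemma sum_list_grow_fringe_ge:
  assumes "dary d t" "1 \<le> k"
  shows "(\<Sum>s\<leftarrow>grow d () t. fringe_ge (Suc k) s) = slots (tree_size t) * fringe_ge (Suc k) t +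
    slots k * (fringe_ge k t - fringe_ge (Suc k) t)"
proof -
  let ?f = "\<lambda>j u. of_bool (j \<le> tree_size (u :: unit dtree)) :: real"
  have "drift d () (?f (Suc k)) u = slots k * (?f k u + (-1) * ?f (Suc k) u)" if "dary d u" for u
    using sum_list_grow_size[OF that, of "\<lambda>j. of_bool (Suc k \<le> j)"] that
    by (cases "tree_size u = k") (auto simp: drift_def length_grow_slots)
  then have "fringe_sum (drift d () (?f (Suc k))) t = fringe_sum (\<lambda>u. slots k * (?f k u + (-1) * ?f (Suc k) u)) t"
    using assms by (intro fringe_sum_cong) auto
  also have "\<dots> = slots k * (fringe_ge k t - fringe_ge (Suc k) t)"
    by (simp only: fringe_sum_cmult fringe_sum_add fringe_ge_def) simp
  finally show ?thesis
    using assms(2) by (simp add: fringe_ge_def sum_list_grow_fringe_sum length_grow_slots[OF assms(1)] sum_list_replicate)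
qed

text \<open>The fringe subtrees that grow lie on the path from the root to the new leaf; their sizes
  are distinct, so at most one of them reaches \<open>k\<close>.\<close>

lemma grow_fringe_ge_cases:
  "s \<in> set (grow d x t) \<Longrightarrow> dary d t \<Longrightarrow> 2 \<le> k \<Longrightarrow>
     fringe_ge k s = fringe_ge k t \<or> fringe_ge k s = fringe_ge k t + 1"
  "ss \<in> set (grows d x ts) \<Longrightarrow> \<forall>t\<in>set ts. dary d t \<Longrightarrow> 2 \<le> k \<Longrightarrow>
     (\<Sum>s\<leftarrow>ss. fringe_ge k s) = (\<Sum>t\<leftarrow>ts. fringe_ge k t) \<or>
     (\<Sum>s\<leftarrow>ss. fringe_ge k s) = (\<Sum>t\<leftarrow>ts. fringe_ge k t) + 1"
proof (induction d x t and d x ts arbitrary: s and ss rule: grow_grows.induct)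
  case (1 d x)
  then show ?case by (simp add: fringe_ge_def sum_list_replicate)
next
  case (2 d x a ts)
  then obtain ss where ss: "ss \<in> set (grows d x ts)" "s = Node a ss" by auto
  have size: "(\<Sum>s\<leftarrow>ss. tree_size s) = Suc (\<Sum>t\<leftarrow>ts. tree_size t)"
    using grow_dary(2)[of ts d ss x] ss 2 by simp
  show ?case
  proof (cases "k \<le> tree_size (Node a ts)")
    case True
    then show ?thesis using 2(1)[OF ss(1)] 2(3,4) ss size by (auto simp: fringe_ge_def)
  next
    case False
    \<comment> \<open>The children hold fewer than \<open>k\<close> vertices even after the
      insertion, so only the root can reach the threshold.\<close>
    have "(\<Sum>s\<leftarrow>ss. fringe_ge k s) = 0"
    proof -
      have "fringe_ge k s = 0" if "s \<in> set ss" for s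
        using tree_size_le_sum[OF that] False size by (intro fringe_ge_eq_0) simp
      then show ?thesis by (metis map_eq_conv sum_list_0)
    qed
    moreover have "fringe_ge k (Node a ts) = 0" using False by (intro fringe_ge_eq_0) simp
    ultimately show ?thesis using ss by (simp add: fringe_ge_def)
  qed
next
  case (4 d x t ts)
  from 4(3) consider s where "s \<in> set (grow d x t)" "ss = s # ts"
    | rs where "rs \<in> set (grows d x ts)" "ss = t # rs" by auto
  then show ?case
  proof cases
    case 1
    then show ?thesis using 4(1)[of s] 4(4,5) by auto
  next
    case 2
    then show ?thesis using 4(2)[of rs] 4(4,5) by auto
  qed
qed simp

text \<open>This is \<open>sum_list_grow_fringe_ge\<close> in expectation. The case
  \<open>k = n\<close> is separate since \<open>mean_fringe_ge n (Suc n)\<close> is 0.\<close>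

lemma mean_fringe_ge_Suc:
  assumes "1 \<le> k" "k \<le> n"
  shows "mean_fringe_ge (Suc n) (Suc k) = mean_fringe_ge n (Suc k) +
    slots k / slots n * (mean_fringe_ge n k - mean_fringe_ge n (Suc k))"
proof -
  define D where "D = real d - 1"
  have D: "D > 0" "real d = D + 1" using d_ge_2 by (auto simp: D_def)
  have S: "slots (Suc j) = slots j + D" for j by (simp add: slots_def D_def algebra_simps)
  have pos: "slots k + D \<noteq> 0" "slots n + D \<noteq> 0" using D slots_pos[of k] slots_pos[of n] by linarith+
  show ?thesis
  proof (cases "k = n")
    case True
    then show ?thesis using D pos by (simp add: mean_fringe_ge_def S)
  next
    case False
    then show ?thesis using D pos assms by (simp add: mean_fringe_ge_def S divide_simps) (simp add: algebra_simps)
  qed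
qed

lemma convex_combination_square_le:
  fixes q :: real
  assumes "0 \<le> q" "q \<le> 1"
  shows "((1 - q) * a + q * b)\<^sup>2 \<le> (1 - q) * a\<^sup>2 + q * b\<^sup>2"
proof -
  have "(1 - q) * a\<^sup>2 + q * b\<^sup>2 - ((1 - q) * a + q * b)\<^sup>2 = q * (1 - q) * (a - b)\<^sup>2"
    by (simp add: power2_eq_square algebra_simps)
  moreover have "0 \<le> q * (1 - q) * (a - b)\<^sup>2" using assms by simp
  ultimately show ?thesis by linarith
qed

lemma mean_fringe_ge_1: "mean_fringe_ge n 1 = real n"
proof (cases n)
  case 0
  then show ?thesis by (simp add: mean_fringe_ge_def)
next
  case (Suc m)
  then show ?thesis using d_ge_2 by (simp add: mean_fringe_ge_def slots_def field_simps)
qed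

text \<open>One insertion raises the count by 0 or 1, so it adds at most 1 to the variance; the expected
  count after the insertion is a convex combination of the counts for \<open>k\<close> and \<open>k - 1\<close>, so it
  adds nothing.\<close>

lemma fringe_ge_variance:
  assumes "1 \<le> k"
  shows "mean n (\<lambda>t. (fringe_ge k t - mean_fringe_ge n k)\<^sup>2) \<le> real n"
  using assms
proof (induction n arbitrary: k)
  case 0
  then show ?case by (simp add: fringe_ge_def mean_fringe_ge_def)
next
  case (Suc n)
  show ?case
  proof (cases "k = 1")
    case True
    have "mean (Suc n) (\<lambda>t. (fringe_ge k t - mean_fringe_ge (Suc n) k)\<^sup>2) = mean (Suc n) (\<lambda>t. 0)"
      by (rule mean_cong) (simp only: True fringe_ge_1 mean_fringe_ge_1, simp)
    then show ?thesis by (simp del: mean.simps)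
  next
    case k1: False
    show ?thesis
    proof (cases "k \<le> Suc n")
      case False
      have "mean (Suc n) (\<lambda>t. (fringe_ge k t - mean_fringe_ge (Suc n) k)\<^sup>2) = mean (Suc n) (\<lambda>t. 0)"
        by (rule mean_cong) (use False in \<open>simp add: fringe_ge_eq_0 mean_fringe_ge_def\<close>)
      then show ?thesis by (simp del: mean.simps)
    next
      case True
      obtain j where j: "k = Suc j" "1 \<le> j" "j \<le> n" using k1 Suc.prems True by (cases k) auto
      define q where "q = slots j / slots n"
      have q: "0 \<le> q" "q \<le> 1" using slots_mono[OF j(3)] by (simp_all add: q_def less_imp_le)
      define c where "c = mean_fringe_ge (Suc n) k"
      have c: "c = mean_fringe_ge n k + q * (mean_fringe_ge n j - mean_fringe_ge n k)"
        unfolding c_def q_def j(1) by (rule mean_fringe_ge_Suc[OF j(2,3)])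
      let ?V = "\<lambda>k t. (fringe_ge k t - mean_fringe_ge n k)\<^sup>2"
      have step: "(\<Sum>s\<leftarrow>grow d () t. (fringe_ge k s - c)\<^sup>2) / slots n \<le> ((1 - q) * ?V k t + q * ?V j t) + 1"
        if t: "dary d t" "tree_size t = n" for t
      proof -
        let ?z = "fringe_ge k t" and ?y = "fringe_ge j t - fringe_ge k t"
        \<comment> \<open>The increment of the count is 0 or 1, hence equal to its square, so the
          new square is affine in it.\<close>
        have "(fringe_ge k s - c)\<^sup>2 = (?z - c)\<^sup>2 + (2 * (?z - c) + 1) * (fringe_ge k s - ?z)"
          if "s \<in> set (grow d () t)" for s
          using grow_fringe_ge_cases(1)[OF that t(1), of k] j by (auto simp: power2_eq_square algebra_simps)
        then have "(\<Sum>s\<leftarrow>grow d () t. (fringe_ge k s - c)\<^sup>2) =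
          (\<Sum>s\<leftarrow>grow d () t. (?z - c)\<^sup>2 + (2 * (?z - c) + 1) * (fringe_ge k s - ?z))"
          by (intro arg_cong[where f = sum_list] map_cong) auto
        also have "\<dots> = slots n * (?z - c)\<^sup>2 + (2 * (?z - c) + 1) * (slots j * ?y)"
          using sum_list_grow_fringe_ge[OF t(1) j(2)]
          by (simp add: sum_list_addf sum_list_const_mult sum_list_subtractf sum_list_triv
              length_grow_slots[OF t(1)] t(2) j(1))
        finally have "(\<Sum>s\<leftarrow>grow d () t. (fringe_ge k s - c)\<^sup>2) / slots n =
            (?z - c)\<^sup>2 + (2 * (?z - c) + 1) * (q * ?y)"
          by (simp add: q_def field_simps)
        \<comment> \<open>\<open>q * ?y\<close> is the conditional probability that the count rises;
          the sum splits into the squared conditional mean and the conditional variance.\<close>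
        also have "\<dots> = (?z - c + q * ?y)\<^sup>2 + (q * ?y - (q * ?y)\<^sup>2)"
          by (simp add: power2_eq_square algebra_simps)
        also have "q * ?y - (q * ?y)\<^sup>2 \<le> 1"
          using zero_le_power2[of "q * ?y - 1/2"] by (simp add: power2_eq_square algebra_simps)
        \<comment> \<open>The recursion for \<open>c\<close> centres both counts and leaves a convex
          combination of their deviations.\<close>
        also have "?z - c + q * ?y =
            (1 - q) * (?z - mean_fringe_ge n k) + q * (fringe_ge j t - mean_fringe_ge n j)"
          by (simp add: c algebra_simps)
        also have "(\<dots>)\<^sup>2 \<le> (1 - q) * ?V k t + q * ?V j t"
          using q by (rule convex_combination_square_le)
        finally show ?thesis by simp
      qed
      have "mean (Suc n) (\<lambda>t. (fringe_ge k t - c)\<^sup>2) \<le> mean n (\<lambda>t. ((1 - q) * ?V k t + q * ?V j t) + 1)"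
        unfolding mean.simps by (rule mean_mono) (rule step)
      also have "\<dots> = (1 - q) * mean n (?V k) + q * mean n (?V j) + 1"
        by (simp only: mean_add mean_cmult mean_const)
      also have "\<dots> \<le> (1 - q) * real n + q * real n + 1"
        using Suc.IH[of k] Suc.IH[of j] Suc.prems j q by (intro add_mono mult_left_mono) auto
      finally show ?thesis by (simp add: c_def algebra_simps)
    qed
  qed
qed

text \<open>In place of Cauchy-Schwarz, \<open>\<bar>x\<bar> \<le> x^2 / (2 * r) + r / 2\<close> is
  averaged with \<open>r = sqrt n\<close>; by the variance bound each term is at most
  \<open>sqrt n / 2\<close>.\<close>

lemma fringe_ge_deviation:
  assumes "1 \<le> k" "1 \<le> n"
  shows "mean n (\<lambda>t. \<bar>fringe_ge k t - mean_fringe_ge n k\<bar>) \<le> sqrt (real n)"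
proof -
  let ?r = "sqrt (real n)"
  have r: "?r > 0" using assms by simp
  have *: "\<bar>x\<bar> \<le> (1 / (2 * ?r)) * x\<^sup>2 + ?r / 2" for x :: real
  proof -
    have "0 \<le> (\<bar>x\<bar> - ?r)\<^sup>2" by simp
    then have "2 * (\<bar>x\<bar> * ?r) \<le> x\<^sup>2 + ?r\<^sup>2" by (simp add: power2_diff)
    then show ?thesis using r by (simp add: field_simps power2_eq_square del: real_sqrt_mult_self)
  qed
  have "mean n (\<lambda>t. \<bar>fringe_ge k t - mean_fringe_ge n k\<bar>) \<le>
    mean n (\<lambda>t. (1 / (2 * ?r)) * (fringe_ge k t - mean_fringe_ge n k)\<^sup>2 + ?r / 2)"
    by (rule mean_mono) (rule *)
  also have "\<dots> = (1 / (2 * ?r)) * mean n (\<lambda>t. (fringe_ge k t - mean_fringe_ge n k)\<^sup>2) + ?r / 2"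
    by (simp only: mean_add mean_cmult mean_const)
  also have "\<dots> \<le> (1 / (2 * ?r)) * real n + ?r / 2"
    using fringe_ge_variance[OF assms(1), of n] r by (intro add_mono mult_left_mono) auto
  also have "\<dots> = ?r" using r by (simp add: real_div_sqrt field_simps)
  finally show ?thesis .
qed

end

section \<open>Pairs of disjoint fringe subtrees\<close>

text \<open>The pairs are ordered, and neither of the two subtrees contains the other.\<close>

fun pair_sum :: "('a dtree \<Rightarrow> 'a dtree \<Rightarrow> real) \<Rightarrow> 'a dtree \<Rightarrow> real"
  and pair_sum_list :: "('a dtree \<Rightarrow> 'a dtree \<Rightarrow> real) \<Rightarrow> 'a dtree list \<Rightarrow> real" where
  "pair_sum g Empty = 0"
| "pair_sum g (Node a ts) = pair_sum_list g ts"
| "pair_sum_list g [] = 0"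
| "pair_sum_list g (t # ts) = pair_sum g t + pair_sum_list g ts +
     fringe_sum (\<lambda>u. \<Sum>s\<leftarrow>ts. fringe_sum (\<lambda>v. g u v + g v u) s) t"

text \<open>Two disjoint subtrees never receive the same new leaf, so a growth step acts on one
  argument at a time.\<close>

definition drift2 :: "nat \<Rightarrow> 'a \<Rightarrow> ('a dtree \<Rightarrow> 'a dtree \<Rightarrow> real) \<Rightarrow> 'a dtree \<Rightarrow> 'a dtree \<Rightarrow> real" where
  "drift2 d x g u v = drift d x (\<lambda>u. g u v) u + drift d x (g u) v"

lemma fringe_sum_sum_list: "fringe_sum (\<lambda>u. \<Sum>i\<leftarrow>is. f i u) t = (\<Sum>i\<leftarrow>is. fringe_sum (f i) t)"
  by (induction "is") (simp_all add: fringe_sum_add)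

lemma drift_add: "drift d x (\<lambda>u. f u + g u) t = drift d x f t + drift d x g t"
  by (simp add: drift_def sum_list_addf algebra_simps)

lemma drift_zero [simp]: "drift d x (\<lambda>u. 0) t = 0"
  by (simp add: drift_def)

lemma drift_sum_list: "drift d x (\<lambda>u. \<Sum>i\<leftarrow>is. f i u) t = (\<Sum>i\<leftarrow>is. drift d x (f i) t)"
  by (induction "is") (simp_all add: drift_add)

lemma drift_fringe_sum:
  "drift d x (\<lambda>u. fringe_sum (\<lambda>v. g u v) s) t = fringe_sum (\<lambda>v. drift d x (\<lambda>u. g u v) t) s"
proof -
  have "fringe_sum (\<lambda>v. (\<Sum>u\<leftarrow>grow d x t. g u v) + (- real (length (grow d x t))) * g t v) s =
     (\<Sum>u\<leftarrow>grow d x t. fringe_sum (g u) s) + (- real (length (grow d x t))) * fringe_sum (g t) s"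
    by (simp only: fringe_sum_add fringe_sum_cmult fringe_sum_sum_list)
  then show ?thesis by (simp add: drift_def)
qed

text \<open>The last two summands count the pairs formed by the new leaf and a subtree it is not inserted
  into.\<close>

lemma sum_list_grow_pair_sum:
  defines "\<phi> \<equiv> \<lambda>d x g v. g (leaf d x) v + g v (leaf d x)"
  shows "(\<Sum>s\<leftarrow>grow d x t. pair_sum g s) =
     real (length (grow d x t)) * pair_sum g t + pair_sum (drift2 d x g) t +
     real (length (grow d x t)) * fringe_sum (\<phi> d x g) t -
     fringe_sum (\<lambda>v. real (length (grow d x v)) * \<phi> d x g v) t" (is "?P d x t")
    and "(\<Sum>ss\<leftarrow>grows d x ts. pair_sum_list g ss) =
     real (length (grows d x ts)) * pair_sum_list g ts + pair_sum_list (drift2 d x g) ts +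
     real (length (grows d x ts)) * (\<Sum>t\<leftarrow>ts. fringe_sum (\<phi> d x g) t) -
     (\<Sum>t\<leftarrow>ts. fringe_sum (\<lambda>v. real (length (grow d x v)) * \<phi> d x g v) t)" (is "?Q d x ts")
proof (induction d x t and d x ts rule: grow_grows.induct)
  case (1 d x)
  have "pair_sum_list g (replicate n Empty) = 0" for n by (induction n) auto
  then show ?case by simp
next
  case (2 d x a ts)
  then show ?case by (simp add: o_def algebra_simps)
next
  case (3 d x)
  then show ?case by simp
next
  case (4 d x t ts)
  let ?h = "\<lambda>g u v. g u v + g v u"
  let ?L = "real (length (grow d x t))" and ?M = "real (length (grows d x ts))"
  let ?C = "\<lambda>g t ts. fringe_sum (\<lambda>u. \<Sum>s\<leftarrow>ts. fringe_sum (?h g u) s) t"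
  have drift_h: "drift d x (\<lambda>u. \<Sum>s\<leftarrow>ts. fringe_sum (?h g u) s) =
     (\<lambda>u. \<Sum>s\<leftarrow>ts. fringe_sum (\<lambda>v. drift d x (\<lambda>u. ?h g u v) u) s)"
    by (rule ext) (simp only: drift_sum_list drift_fringe_sum)
  \<comment> \<open>An insertion into \<open>t\<close> affects only the first argument of
    \<open>?h\<close> in the cross pairs, and one into a later sibling only the second; each case is
    a fringe sum with the other argument fixed.\<close>
  have left: "(\<Sum>s\<leftarrow>grow d x t. ?C g s ts) = ?L * (?C g t ts + (\<Sum>s\<leftarrow>ts. fringe_sum (\<phi> d x g) s)) +
     fringe_sum (\<lambda>u. \<Sum>s\<leftarrow>ts. fringe_sum (\<lambda>v. drift d x (\<lambda>u. ?h g u v) u) s) t"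
    by (simp only: sum_list_grow_fringe_sum drift_h) (simp add: \<phi>_def)
  have "(\<Sum>ss\<leftarrow>grows d x ts. ?C g t ss) =
     fringe_sum (\<lambda>u. \<Sum>ss\<leftarrow>grows d x ts. \<Sum>s\<leftarrow>ss. fringe_sum (?h g u) s) t"
    by (simp only: fringe_sum_sum_list)
  also have "\<dots> = fringe_sum (\<lambda>u. ?M * ((\<Sum>s\<leftarrow>ts. fringe_sum (?h g u) s) + \<phi> d x g u) +
     (\<Sum>s\<leftarrow>ts. fringe_sum (\<lambda>v. drift d x (?h g u) v) s)) t"
    by (simp add: sum_list_grow_fringe_sum \<phi>_def add.commute)
  also have "\<dots> = ?M * (?C g t ts + fringe_sum (\<phi> d x g) t) +
     fringe_sum (\<lambda>u. \<Sum>s\<leftarrow>ts. fringe_sum (\<lambda>v. drift d x (?h g u) v) s) t"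
    by (simp only: fringe_sum_add fringe_sum_cmult)
  finally have right: "(\<Sum>ss\<leftarrow>grows d x ts. ?C g t ss) =
     ?M * (?C g t ts + fringe_sum (\<phi> d x g) t) +
     fringe_sum (\<lambda>u. \<Sum>s\<leftarrow>ts. fringe_sum (\<lambda>v. drift d x (?h g u) v) s) t" .
  have "?h (drift2 d x g) u v = drift d x (\<lambda>u. ?h g u v) u + drift d x (?h g u) v" for u v
    by (simp add: drift2_def drift_add)
  then have cross: "?C (drift2 d x g) t ts =
     fringe_sum (\<lambda>u. \<Sum>s\<leftarrow>ts. fringe_sum (\<lambda>v. drift d x (\<lambda>u. ?h g u v) u) s) t +
     fringe_sum (\<lambda>u. \<Sum>s\<leftarrow>ts. fringe_sum (\<lambda>v. drift d x (?h g u) v) s) t"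
    by (simp only: fringe_sum_add sum_list_addf)
  have "(\<Sum>ss\<leftarrow>grows d x (t # ts). pair_sum_list g ss) =
     (\<Sum>s\<leftarrow>grow d x t. pair_sum g s) + ?L * pair_sum_list g ts + (\<Sum>s\<leftarrow>grow d x t. ?C g s ts) +
     (?M * pair_sum g t + (\<Sum>ss\<leftarrow>grows d x ts. pair_sum_list g ss) + (\<Sum>ss\<leftarrow>grows d x ts. ?C g t ss))"
    by (simp add: o_def sum_list_addf sum_list_triv)
  also have "\<dots> = real (length (grows d x (t # ts))) * pair_sum_list g (t # ts) +
     pair_sum_list (drift2 d x g) (t # ts) +
     real (length (grows d x (t # ts))) * (\<Sum>t\<leftarrow>t # ts. fringe_sum (\<phi> d x g) t) -
     (\<Sum>t\<leftarrow>t # ts. fringe_sum (\<lambda>v. real (length (grow d x v)) * \<phi> d x g v) t)"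
    unfolding left right 4 by (simp add: cross algebra_simps)
  finally show ?case .
qed

lemma pair_sum_mono:
  fixes t :: "'a dtree"
  assumes "\<And>u v. dary d u \<Longrightarrow> dary d v \<Longrightarrow> g u v \<le> h u v"
  shows "dary d t \<Longrightarrow> pair_sum g t \<le> pair_sum h t"
    and "\<forall>t\<in>set ts. dary d t \<Longrightarrow> pair_sum_list g ts \<le> pair_sum_list h ts"
  using assms
proof (induction g t and g ts rule: pair_sum_pair_sum_list.induct)
  case (4 g t ts)
  then show ?case
    by (auto intro!: add_mono fringe_sum_mono[where d = d] sum_list_mono)
qed auto

lemma pair_sum_cong:
  assumes "dary d t" "\<And>u v. dary d u \<Longrightarrow> dary d v \<Longrightarrow> g u v = h u v"
  shows "pair_sum g t = pair_sum h t"
  using assms(1) pair_sum_mono(1)[of d g h t] pair_sum_mono(1)[of d h g t] assms(2) by fastforce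

text \<open>There are at most \<open>n^2\<close> ordered pairs of vertices; in the induction the
  cross term supplies the \<open>2 a b\<close> of \<open>(a + b)^2\<close>.\<close>

lemma pair_sum_const_le:
  fixes t :: "'a dtree"
  assumes "0 \<le> c" "g = (\<lambda>_ _. c)"
  shows "pair_sum g t \<le> c * (real (tree_size t))\<^sup>2"
    and "pair_sum_list g ts \<le> c * (real (\<Sum>t\<leftarrow>ts. tree_size t))\<^sup>2"
  using assms(2)
proof (induction g t and g ts rule: pair_sum_pair_sum_list.induct)
  case (2 g a ts)
  have "c * (real (\<Sum>t\<leftarrow>ts. tree_size t))\<^sup>2 \<le> c * (real (tree_size (Node a ts)))\<^sup>2"
    using assms(1) by (intro mult_left_mono power_mono) auto
  then show ?case using 2 by simp
next
  case (4 g t ts)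
  have "fringe_sum (\<lambda>u. c + c) s = 2 * c * real (tree_size s)" for s :: "'a dtree"
    using fringe_sum_cmult[of "2 * c" "\<lambda>_. 1" s] by (simp add: fringe_sum_one)
  moreover have "fringe_sum (\<lambda>u. e) t = e * real (tree_size t)" for e
    using fringe_sum_cmult[of e "\<lambda>_. 1" t] by (simp add: fringe_sum_one)
  ultimately have "fringe_sum (\<lambda>u. \<Sum>s\<leftarrow>ts. fringe_sum (\<lambda>v. c + c) s) t =
      2 * c * real (\<Sum>s\<leftarrow>ts. tree_size s) * real (tree_size t)"
    by (simp add: sum_list_const_mult real_sum_list)
  then show ?case using 4 by (simp add: power2_eq_square algebra_simps)
qed auto

section \<open>Independence of disjoint fringe subtrees\<close>

context dary_growth
begin

definition avg2 :: "(unit dtree \<Rightarrow> unit dtree \<Rightarrow> real) \<Rightarrow> unit dtree \<Rightarrow> unit dtree \<Rightarrow> real" where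
  "avg2 g u v = mean (tree_size u) (\<lambda>u. mean (tree_size v) (g u))"

lemma drift_mean:
  "drift d x (\<lambda>u. mean n (g u)) t = mean n (\<lambda>v. drift d x (\<lambda>u. g u v) t)"
  by (simp add: drift_def mean_diff mean_cmult mean_sum_list)

lemma drift2_avg2:
  assumes "dary d u" "dary d v"
  shows "drift2 d () (avg2 g) u v = avg2 (drift2 d () g) u v"
proof -
  let ?k = "tree_size u" and ?l = "tree_size v"
  have "drift d () (\<lambda>u. avg2 g u v) u = mean ?k (drift d () (\<lambda>u. mean ?l (g u)))"
  proof -
    have "(\<lambda>u. avg2 g u v) = avg (\<lambda>u. mean ?l (g u))"
      by (rule ext) (simp only: avg2_def avg_def)
    then show ?thesis
      using drift_avg[OF assms(1), of "\<lambda>u. mean ?l (g u)"] by (simp only: avg_def)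
  qed
  also have "\<dots> = mean ?k (\<lambda>u. mean ?l (\<lambda>v. drift d () (\<lambda>u. g u v) u))"
    by (intro arg_cong[where f = "mean ?k"] ext drift_mean)
  finally have 1: "drift d () (\<lambda>u. avg2 g u v) u = \<dots>" .
  have "drift d () (avg2 g u) v = mean ?k (\<lambda>u. drift d () (avg (g u)) v)"
    unfolding avg2_def avg_def by (simp only: drift_mean[symmetric])
  also have "\<dots> = mean ?k (\<lambda>u. mean ?l (drift d () (g u)))"
    by (simp only: drift_avg[OF assms(2)]) (simp only: avg_def)
  finally have 2: "drift d () (avg2 g u) v = \<dots>" .
  have "drift2 d () g = (\<lambda>u v. drift d () (\<lambda>u. g u v) u + drift d () (g u) v)"
    by (intro ext) (rule drift2_def)
  then have "avg2 (drift2 d () g) u v = mean ?k (\<lambda>u. mean ?l (\<lambda>v. drift d () (\<lambda>u. g u v) u)) +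
      mean ?k (\<lambda>u. mean ?l (drift d () (g u)))"
    by (simp only: avg2_def mean_add)
  then show ?thesis by (simp only: drift2_def 1 2)
qed

lemma mean_1: "mean (Suc 0) f = f (leaf d ())"
  by (simp add: slots_def)

lemma mean_Suc_pair_sum:
  fixes g :: "unit dtree \<Rightarrow> unit dtree \<Rightarrow> real"
  defines "\<phi> \<equiv> \<lambda>v. g (leaf d ()) v + g v (leaf d ())"
  shows "mean (Suc n) (pair_sum g) = mean n (pair_sum g) + mean n (pair_sum (drift2 d () g)) / slots n +
    mean n (fringe_sum \<phi>) - mean n (fringe_sum (\<lambda>v. slots (tree_size v) * \<phi> v)) / slots n"
proof -
  have "mean (Suc n) (pair_sum g) = mean n (\<lambda>t. (pair_sum g t + (1 / slots n) * pair_sum (drift2 d () g) t +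
     fringe_sum \<phi> t) - (1 / slots n) * fringe_sum (\<lambda>v. slots (tree_size v) * \<phi> v) t)"
    unfolding mean.simps
  proof (rule mean_cong)
    fix t :: "unit dtree" assume t: "dary d t" "tree_size t = n"
    have "fringe_sum (\<lambda>v. real (length (grow d () v)) * \<phi> v) t = fringe_sum (\<lambda>v. slots (tree_size v) * \<phi> v) t"
      using t by (intro fringe_sum_cong[where d = d]) (simp_all add: length_grow_slots)
    then show "(\<Sum>s\<leftarrow>grow d () t. pair_sum g s) / slots n = (pair_sum g t + (1 / slots n) * pair_sum (drift2 d () g) t +
     fringe_sum \<phi> t) - (1 / slots n) * fringe_sum (\<lambda>v. slots (tree_size v) * \<phi> v) t"
      using t by (simp add: sum_list_grow_pair_sum length_grow_slots \<phi>_def field_simps)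
  qed
  then show ?thesis by (simp only: mean_add mean_diff mean_cmult) simp
qed

text \<open>Given their sizes, disjoint fringe subtrees are independent random trees: averaging over each
  of them separately commutes with the growth step.\<close>

lemma mean_pair_sum_avg2: "mean n (pair_sum g) = mean n (pair_sum (avg2 g))"
proof (induction n arbitrary: g)
  case (Suc n)
  let ?\<phi> = "\<lambda>g v. g (leaf d ()) v + g v (leaf d ())"
  have size_leaf: "tree_size (leaf d ()) = Suc 0" by (simp add: sum_list_replicate)
  have phi: "?\<phi> (avg2 g) v = avg (?\<phi> g) v" for v
    unfolding avg2_def size_leaf mean_1 avg_def mean_add ..
  have "mean n (pair_sum (drift2 d () g)) = mean n (pair_sum (drift2 d () (avg2 g)))"
    unfolding Suc[of "drift2 d () g"]
    by (rule mean_cong) (auto intro!: pair_sum_cong simp: drift2_avg2)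
  moreover have "mean n (fringe_sum (?\<phi> g)) = mean n (fringe_sum (?\<phi> (avg2 g)))"
    unfolding phi by (rule mean_fringe_sum_avg)
  moreover have "mean n (fringe_sum (\<lambda>v. slots (tree_size v) * ?\<phi> g v)) =
     mean n (fringe_sum (\<lambda>v. slots (tree_size v) * ?\<phi> (avg2 g) v))"
  proof -
    have "avg (\<lambda>v. slots (tree_size v) * ?\<phi> g v) v = slots (tree_size v) * avg (?\<phi> g) v" for v
      unfolding avg_def mean_cmult[symmetric] by (rule mean_cong) simp
    then show ?thesis
      unfolding phi mean_fringe_sum_avg[of n "\<lambda>v. slots (tree_size v) * ?\<phi> g v"] by presburger
  qed
  ultimately show ?case
    by (simp only: mean_Suc_pair_sum Suc[of g])
qed simp

text \<open>After averaging, every pair contributes at most \<open>c\<close>, and there are at most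
  \<open>n^2\<close> pairs.\<close>

lemma mean_pair_sum_le:
  assumes "0 \<le> c" "\<And>u v. dary d u \<Longrightarrow> dary d v \<Longrightarrow> avg2 g u v \<le> c"
  shows "mean n (pair_sum g) \<le> c * (real n)\<^sup>2"
proof -
  have "mean n (pair_sum g) \<le> mean n (\<lambda>t. c * (real n)\<^sup>2)"
    unfolding mean_pair_sum_avg2[of n g]
  proof (rule mean_mono)
    fix t :: "unit dtree" assume t: "dary d t" "tree_size t = n"
    have "pair_sum (avg2 g) t \<le> pair_sum (\<lambda>_ _. c) t"
      using t(1) assms(2) by (rule pair_sum_mono(1)[rotated])
    also have "\<dots> \<le> c * (real n)\<^sup>2"
      using pair_sum_const_le(1)[OF assms(1) refl, of t] t(2) by simp
    finally show "pair_sum (avg2 g) t \<le> c * (real n)\<^sup>2" .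
  qed
  then show ?thesis by simp
qed

end

section \<open>Shapes and their probabilities\<close>

text \<open>The possible predecessors in the growth process, one entry for each leaf that is
  removed. A node whose children are all \<open>Empty\<close> is such a leaf.\<close>

fun prunings :: "'a dtree \<Rightarrow> 'a dtree list"
  and prunings_list :: "'a dtree list \<Rightarrow> 'a dtree list list" where
  "prunings Empty = []"
| "prunings (Node a ts) =
     (if \<forall>t\<in>set ts. t = Empty then [Empty] else map (Node a) (prunings_list ts))"
| "prunings_list [] = []"
| "prunings_list (t # ts) = map (\<lambda>s. s # ts) (prunings t) @ map (Cons t) (prunings_list ts)"

lemma count_list_map_Node:
  "count_list (map (Node a) xs) (Node a y) = count_list xs y"
  "count_list (map (Node a) xs) Empty = 0"
  by (induction xs) auto

lemma count_list_map_Cons: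
  "count_list (map (\<lambda>s. s # ts) xs) (u # us) = (if us = ts then count_list xs u else 0)"
  "count_list (map (Cons t) xss) (u # us) = (if u = t then count_list xss us else 0)"
proof -
  show "count_list (map (\<lambda>s. s # ts) xs) (u # us) = (if us = ts then count_list xs u else 0)"
    by (induction xs) auto
  show "count_list (map (Cons t) xss) (u # us) = (if u = t then count_list xss us else 0)"
    by (induction xss) auto
qed

text \<open>Inserting and removing a leaf are inverse, so both sides count the same steps from
  \<open>t\<close> to \<open>s\<close>. With unit labels no information is lost when the removed
  label is forgotten.\<close>

lemma count_grow_eq_count_prunings:
  fixes s t :: "unit dtree"
  shows "dary d t \<Longrightarrow> dary d s \<Longrightarrow> count_list (grow d x t) s = count_list (prunings s) t"
    and "\<forall>t\<in>set ts. dary d t \<Longrightarrow> \<forall>s\<in>set ss. dary d s \<Longrightarrow> length ss = length ts \<Longrightarrow>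
      count_list (grows d x ts) ss = count_list (prunings_list ss) ts"
proof (induction d x t and d x ts arbitrary: s and ss rule: grow_grows.induct)
  case (1 d x)
  show ?case
  proof (cases s)
    case (Node a ss)
    have "s = leaf d x \<longleftrightarrow> (\<forall>t\<in>set ss. t = Empty)"
      using Node 1 by (auto intro!: replicate_eqI simp: in_set_replicate dest: arg_cong[where f = set])
    then show ?thesis using Node by (auto simp: count_list_map_Node)
  qed simp
next
  case (2 d x a ts)
  show ?case
  proof (cases s)
    case (Node b ss)
    have "count_list (grows d x ts) ss = 0" if "\<forall>t\<in>set ss. t = Empty"
    proof (rule count_notin)
      have "(\<Sum>s\<leftarrow>ss. tree_size s) = 0" using that by (induction ss) auto
      moreover have "(\<Sum>s\<leftarrow>ss. tree_size s) = Suc (\<Sum>t\<leftarrow>ts. tree_size t)" if "ss \<in> set (grows d x ts)"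
        using grow_dary(2)[OF _ that] 2(2) by simp
      ultimately show "ss \<notin> set (grows d x ts)" by (metis nat.distinct(1))
    qed
    then show ?thesis using Node 2 by (auto simp: count_list_map_Node)
  qed (simp add: count_list_map_Node)
next
  case (3 d x)
  then show ?case by simp
next
  case (4 d x t ts)
  then obtain u us where "ss = u # us" by (cases ss) auto
  then show ?case using 4 by (auto simp: count_list_map_Cons)
qed

lemma prunings_props:
  fixes t :: "'a dtree" and ts :: "'a dtree list"
  shows "s \<in> set (prunings t) \<Longrightarrow> Suc (tree_size s) = tree_size t \<and> (dary d t \<longrightarrow> dary d s)"
  "ss \<in> set (prunings_list ts) \<Longrightarrow>
     Suc (\<Sum>s\<leftarrow>ss. tree_size s) = (\<Sum>t\<leftarrow>ts. tree_size t) \<and> length ss = length ts \<and>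
     ((\<forall>t\<in>set ts. dary d t) \<longrightarrow> (\<forall>s\<in>set ss. dary d s))"
proof (induction t and ts arbitrary: s and ss rule: prunings_prunings_list.induct)
  case (2 a ts)
  show ?case
  proof (cases "\<forall>t\<in>set ts. t = Empty")
    case True
    then have "(\<Sum>t\<leftarrow>ts. tree_size t) = 0" by (induction ts) auto
    then show ?thesis using 2 True by simp
  next
    case False
    then obtain ss where "ss \<in> set (prunings_list ts)" "s = Node a ss"
      using 2(2) by (auto split: if_splits)
    then show ?thesis using 2(1)[OF False, of ss] by auto
  qed
next
  case (4 t ts)
  from 4(3) consider s where "s \<in> set (prunings t)" "ss = s # ts"
    | rs where "rs \<in> set (prunings_list ts)" "ss = t # rs" by auto
  then show ?case
  proof cases
    case 1
    then show ?thesis using 4(1)[of s] by auto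
  next
    case 2
    then show ?thesis using 4(2)[of rs] by auto
  qed
qed auto

text \<open>The product of the reciprocal hook lengths; times the factorial of the size it counts
  the increasing labellings of a shape.\<close>

fun hook_weight :: "'a dtree \<Rightarrow> real" where
  "hook_weight Empty = 1"
| "hook_weight (Node a ts) = (\<Prod>t\<leftarrow>ts. hook_weight t) / real (tree_size (Node a ts))"

text \<open>The hook length formula in recursive form: the largest label may sit at any leaf, and
  removing a leaf acts on the product over the children by a Leibniz rule.\<close>

lemma sum_prunings_hook_weight:
  fixes t :: "'a dtree" and ts :: "'a dtree list"
  shows "(\<Sum>s\<leftarrow>prunings t. hook_weight s) = real (tree_size t) * hook_weight t"
  "(\<Sum>ss\<leftarrow>prunings_list ts. \<Prod>s\<leftarrow>ss. hook_weight s) =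
     real (\<Sum>t\<leftarrow>ts. tree_size t) * (\<Prod>t\<leftarrow>ts. hook_weight t)"
proof (induction t and ts rule: prunings_prunings_list.induct)
  case (2 a ts)
  show ?case
  proof (cases "\<forall>t\<in>set ts. t = Empty")
    case True
    then have "(\<Sum>t\<leftarrow>ts. tree_size t) = 0" "(\<Prod>t\<leftarrow>ts. hook_weight t) = 1"
      by (induction ts) auto
    then show ?thesis using True by simp
  next
    case False
    let ?n = "\<Sum>t\<leftarrow>ts. tree_size t"
    have "?n \<noteq> 0" using False by (auto simp: sum_list_eq_0_iff)
    have "(\<Sum>s\<leftarrow>prunings (Node a ts). hook_weight s) =
        (\<Sum>ss\<leftarrow>prunings_list ts. (\<Prod>s\<leftarrow>ss. hook_weight s) * (1 / real ?n))"
    proof -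
      \<comment> \<open>Every pruned tree has exactly \<open>?n\<close> vertices, so the root factor
        is common to all of them.\<close>
      have "hook_weight (Node a ss) = (\<Prod>s\<leftarrow>ss. hook_weight s) * (1 / real ?n)"
        if "ss \<in> set (prunings_list ts)" for ss
        using prunings_props(2)[OF that] by (simp del: of_nat_Suc)
      then have "map (\<lambda>ss. hook_weight (Node a ss)) (prunings_list ts) =
         map (\<lambda>ss. (\<Prod>s\<leftarrow>ss. hook_weight s) * (1 / real ?n)) (prunings_list ts)"
        by simp
      moreover have "prunings (Node a ts) = map (Node a) (prunings_list ts)" using False by auto
      ultimately show ?thesis by (simp only: map_map o_def)
    qed
    also have "\<dots> = (\<Prod>t\<leftarrow>ts. hook_weight t)"
      using 2[OF False] \<open>?n \<noteq> 0\<close> by (simp only: sum_list_mult_const) simp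
    finally show ?thesis by (simp del: of_nat_Suc)
  qed
next
  case (4 t ts)
  then show ?case by (simp add: o_def sum_list_const_mult sum_list_mult_const algebra_simps)
qed auto

lemma hook_weight_exp: "hook_weight t = exp (- fringe_sum (\<lambda>u. ln (real (tree_size u))) t)"
proof (induction t)
  case (Node a ts)
  let ?f = "fringe_sum (\<lambda>u. ln (real (tree_size u)))"
  have "(\<Prod>t\<leftarrow>ts. hook_weight t) = (\<Prod>t\<leftarrow>ts. exp (- ?f t))"
    using Node by (metis (no_types, lifting) map_eq_conv)
  also have "\<dots> = exp (- (\<Sum>t\<leftarrow>ts. ?f t))"
    by (induction ts) (auto simp: exp_diff exp_minus field_simps)
  finally show ?case by (simp add: exp_diff exp_minus divide_simps del: of_nat_Suc)
qed simp

section \<open>Distinct fringe subtrees against occurrences\<close>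

lemma finite_fringe_subtrees [simp]: "finite (fringe_subtrees t)"
  by (induction t) auto

lemma fringe_subtrees_size: "u \<in> fringe_subtrees t \<Longrightarrow> tree_size u \<le> tree_size t"
proof (induction t)
  case (Node a ts)
  then show ?case using tree_size_le_sum by (fastforce intro: order.trans le_SucI)
qed simp

lemma fringe_subtrees_dary: "dary d t \<Longrightarrow> u \<in> fringe_subtrees t \<Longrightarrow> dary d u"
  by (induction t) auto

lemma fringe_sum_mono_fringe:
  assumes "\<And>u. u \<in> fringe_subtrees t \<Longrightarrow> f u \<le> g u"
  shows "fringe_sum f t \<le> fringe_sum g t"
  using assms
proof (induction t)
  case (Node a ts)
  then have "(\<Sum>t\<leftarrow>ts. fringe_sum f t) \<le> (\<Sum>t\<leftarrow>ts. fringe_sum g t)"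
    by (intro sum_list_mono) auto
  then show ?case using Node.prems[of "Node a ts"] by auto
qed simp

lemma fringe_sum_nonneg: "(\<And>u. 0 \<le> f u) \<Longrightarrow> 0 \<le> fringe_sum f t"
  using fringe_sum_mono_fringe[of t "\<lambda>_. 0" f] by simp

lemma real_member_le_sum_list:
  fixes f :: "'a \<Rightarrow> real"
  shows "x \<in> set xs \<Longrightarrow> (\<And>y. 0 \<le> f y) \<Longrightarrow> f x \<le> (\<Sum>y\<leftarrow>xs. f y)"
  by (induction xs) (auto simp: add_increasing add_increasing2 intro!: sum_list_nonneg)

lemma fringe_sum_ge_member:
  assumes "u \<in> fringe_subtrees t" "\<And>v. 0 \<le> f v"
  shows "f u \<le> fringe_sum f t"
  using assms(1)
proof (induction t)
  case (Node a ts)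
  show ?case
  proof (cases "u = Node a ts")
    case True
    then show ?thesis by (auto intro!: sum_list_nonneg fringe_sum_nonneg assms(2))
  next
    case False
    then obtain t where t: "t \<in> set ts" "u \<in> fringe_subtrees t" using Node by auto
    have "fringe_sum f t \<le> (\<Sum>t\<leftarrow>ts. fringe_sum f t)"
      using t(1) by (intro real_member_le_sum_list fringe_sum_nonneg assms(2))
    then show ?thesis using Node.IH[OF t] assms(2)[of "Node a ts"] by simp
  qed
qed simp

lemma card_fringe_le:
  "real (card (fringe_subtrees t \<inter> A)) \<le> fringe_sum (\<lambda>u. of_bool (u \<in> A)) t"
proof (induction t)
  case (Node a ts)
  let ?F = "\<lambda>ts. \<Union>t\<in>set ts. fringe_subtrees t"
  have "real (card (?F us \<inter> A)) \<le> (\<Sum>t\<leftarrow>us. fringe_sum (\<lambda>u. of_bool (u \<in> A)) t)"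
    if "set us \<subseteq> set ts" for us
    using that
  proof (induction us)
    case (Cons u us)
    have "card (?F (u # us) \<inter> A) \<le> card (fringe_subtrees u \<inter> A) + card (?F us \<inter> A)"
      by (simp add: Int_Un_distrib2 card_Un_le)
    then show ?case using Cons Node.IH[of u] by (auto simp: of_nat_mono)
  qed simp
  from this[of ts] show ?case
    by (auto simp: Int_insert_left card_insert_if)
qed simp

text \<open>A member of \<open>A\<close> with \<open>m \<ge> 1\<close> occurrences contributes
  \<open>m - m * (m - 1) \<le> 1\<close> on the left. Equal subtrees at different vertices have
  equal size, so neither contains the other and \<open>pair_sum\<close> sees every
  coincidence.\<close>

lemma card_fringe_ge:
  defines "g \<equiv> \<lambda>A u v. of_bool (u = v \<and> u \<in> A)"
  shows "fringe_sum (\<lambda>u. of_bool (u \<in> A)) t - pair_sum (g A) t \<le> real (card (fringe_subtrees t \<inter> A))"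
    and "(\<Sum>t\<leftarrow>ts. fringe_sum (\<lambda>u. of_bool (u \<in> A)) t) - pair_sum_list (g A) ts \<le>
       real (card ((\<Union>t\<in>set ts. fringe_subtrees t) \<inter> A))"
proof (induction "g A" t and "g A" ts rule: pair_sum_pair_sum_list.induct)
  case (2 a ts)
  have "Node a ts \<notin> (\<Union>t\<in>set ts. fringe_subtrees t)"
    using fringe_subtrees_size tree_size_le_sum by (fastforce dest: order.trans)
  then show ?case using 2 by (simp add: Int_insert_left)
next
  case (4 t ts)
  let ?F = "\<Union>t\<in>set ts. fringe_subtrees t"
  \<comment> \<open>The elements shared by \<open>t\<close> and its later siblings are the loss in
    the union; each is charged to a cross pair of equal subtrees.\<close>
  have "real (card (fringe_subtrees t \<inter> (?F \<inter> A))) \<le> fringe_sum (\<lambda>u. of_bool (u \<in> ?F \<inter> A)) t"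
    by (rule card_fringe_le)
  also have "\<dots> \<le> fringe_sum (\<lambda>u. \<Sum>s\<leftarrow>ts. fringe_sum (\<lambda>v. g A u v + g A v u) s) t"
  proof (rule fringe_sum_mono_fringe)
    fix u
    have nn: "0 \<le> g A u v + g A v u" for v by (simp add: g_def)
    show "of_bool (u \<in> ?F \<inter> A) \<le> (\<Sum>s\<leftarrow>ts. fringe_sum (\<lambda>v. g A u v + g A v u) s)"
    proof (cases "u \<in> ?F \<inter> A")
      case True
      then obtain s where s: "s \<in> set ts" "u \<in> fringe_subtrees s" by auto
      have "1 \<le> g A u u + g A u u" using True by (simp add: g_def)
      also have "\<dots> \<le> fringe_sum (\<lambda>v. g A u v + g A v u) s"
        using fringe_sum_ge_member[OF s(2), of "\<lambda>v. g A u v + g A v u"] nn by simp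
      also have "\<dots> \<le> (\<Sum>s\<leftarrow>ts. fringe_sum (\<lambda>v. g A u v + g A v u) s)"
        using s(1) nn by (intro real_member_le_sum_list fringe_sum_nonneg)
      finally show ?thesis using True by simp
    next
      case False
      then show ?thesis using nn by (simp only:) (auto intro!: sum_list_nonneg fringe_sum_nonneg)
    qed
  qed
  finally have collisions: "real (card (fringe_subtrees t \<inter> (?F \<inter> A))) \<le> \<dots>" .
  have "card (fringe_subtrees t \<inter> A) + card (?F \<inter> A) =
     card ((fringe_subtrees t \<union> ?F) \<inter> A) + card (fringe_subtrees t \<inter> (?F \<inter> A))"
    by (subst card_Un_Int) (auto intro!: arg_cong2[where f = "(+)"] arg_cong[where f = card])
  then have "real (card (fringe_subtrees t \<inter> A)) + real (card (?F \<inter> A)) =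
     real (card ((fringe_subtrees t \<union> ?F) \<inter> A)) + real (card (fringe_subtrees t \<inter> (?F \<inter> A)))"
    by linarith
  then show ?case using 4 collisions by simp
qed auto

section \<open>Counting shapes by their generating function\<close>

lemma sum_lists_prod_list:
  fixes f :: "'a \<Rightarrow> real"
  assumes "finite A"
  shows "(\<Sum>ts | set ts \<subseteq> A \<and> length ts = k. \<Prod>t\<leftarrow>ts. f t) = (\<Sum>a\<in>A. f a) ^ k"
proof (induction k)
  case 0
  have "{ts. set ts \<subseteq> A \<and> length ts = 0} = {[]}" by auto
  then show ?case by simp
next
  case (Suc k)
  have "(\<Sum>ts | set ts \<subseteq> A \<and> length ts = Suc k. \<Prod>t\<leftarrow>ts. f t) =
     (\<Sum>(ts, a)\<in>{ts. set ts \<subseteq> A \<and> length ts = k} \<times> A. f a * (\<Prod>t\<leftarrow>ts. f t))"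
    unfolding lists_length_Suc_eq
    by (subst sum.reindex) (auto simp: inj_on_def intro!: sum.cong)
  also have "\<dots> = (\<Sum>ts | set ts \<subseteq> A \<and> length ts = k. \<Prod>t\<leftarrow>ts. f t) * (\<Sum>a\<in>A. f a)"
    unfolding sum_product sum.cartesian_product by (simp add: mult.commute)
  finally show ?case using Suc by simp
qed

text \<open>Truncation by height keeps the recursion for the generating function exact, and it
  includes every tree of size at most \<open>h\<close>.\<close>

fun shapes :: "nat \<Rightarrow> nat \<Rightarrow> unit dtree set" where
  "shapes d 0 = {Empty}"
| "shapes d (Suc h) = insert Empty (Node () ` {ts. set ts \<subseteq> shapes d h \<and> length ts = d})"

lemma finite_shapes: "finite (shapes d h)"
  by (induction h) (auto intro!: finite_imageI finite_lists_length_eq)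

lemma dary_in_shapes: "dary d t \<Longrightarrow> tree_size t \<le> h \<Longrightarrow> t \<in> shapes d h"
proof (induction h arbitrary: t)
  case (Suc h)
  show ?case
  proof (cases t)
    case (Node a ts)
    have "s \<in> shapes d h" if "s \<in> set ts" for s
      using Suc Node that tree_size_le_sum[OF that] by auto
    then show ?thesis using Node Suc.prems by (auto intro!: imageI)
  qed simp
qed simp

text \<open>A Kraft inequality: \<open>y = d / (d - 1)\<close> and \<open>x = (d - 1)^(d - 1) / d^d\<close> solve \<open>y = 1 + x y^d\<close>,
  where \<open>x\<close> is the radius of convergence of the generating function of \<open>d\<close>-ary trees.\<close>

lemma sum_shapes_le:
  fixes d :: nat
  assumes "2 \<le> d"
  defines "x \<equiv> (real d - 1) ^ (d - 1) / real d ^ d"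
  shows "(\<Sum>t\<in>shapes d h. x ^ tree_size t) \<le> real d / (real d - 1)"
proof (induction h)
  case 0
  then show ?case using assms(1) by (simp add: field_simps)
next
  case (Suc h)
  let ?L = "{ts. set ts \<subseteq> shapes d h \<and> length ts = d}" and ?y = "real d / (real d - 1)"
  have x: "0 \<le> x" using assms(1) by (simp add: x_def)
  have prod: "x ^ (\<Sum>t\<leftarrow>ts. tree_size t) = (\<Prod>t\<leftarrow>ts. x ^ tree_size t)" for ts :: "unit dtree list"
    by (induction ts) (auto simp: power_add)
  have "(\<Sum>t\<in>shapes d (Suc h). x ^ tree_size t) = 1 + (\<Sum>t\<in>Node () ` ?L. x ^ tree_size t)"
    using finite_shapes[of d h] by (simp add: finite_lists_length_eq) (subst sum.insert; auto simp: finite_lists_length_eq)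
  also have "(\<Sum>t\<in>Node () ` ?L. x ^ tree_size t) = (\<Sum>ts\<in>?L. x * (\<Prod>t\<leftarrow>ts. x ^ tree_size t))"
    by (subst sum.reindex) (auto simp: inj_on_def prod)
  also have "\<dots> = x * (\<Sum>t\<in>shapes d h. x ^ tree_size t) ^ d"
    by (simp add: sum_lists_prod_list[OF finite_shapes] flip: sum_distrib_left)
  also have "\<dots> \<le> x * ?y ^ d"
    using Suc x by (intro mult_left_mono power_mono sum_nonneg) auto
  also have "1 + x * ?y ^ d = ?y"
  proof -
    obtain e where e: "d = Suc e" "e > 0" using assms(1) by (cases d) auto
    have r: "real d - 1 = real e" "d - 1 = e" "real d \<noteq> 0" using e by auto
    have "x * ?y ^ d = real e ^ e / real e ^ d"
      unfolding x_def r power_divide using r(3) by simp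
    also have "\<dots> = 1 / real e" using e by simp
    finally have "x * ?y ^ d = 1 / real e" .
    then show ?thesis unfolding r(1) using e by (simp add: add_divide_distrib del: power_Suc)
  qed
  finally show ?case by simp
qed

text \<open>With \<open>K\<close> the exponential rate and \<open>x = exp (- K)\<close>, each tree
  of size at most \<open>r\<close> has weight at least \<open>exp (- K * r)\<close> in the Kraft
  sum, which is at most \<open>d / (d - 1) \<le> 2\<close>.\<close>

lemma card_shapes_le:
  fixes d :: nat
  assumes "2 \<le> d"
  shows "finite {t :: unit dtree. dary d t \<and> real (tree_size t) \<le> r}"
    and "real (card {t :: unit dtree. dary d t \<and> real (tree_size t) \<le> r}) \<le>
      2 * exp ((real d * ln (real d) - (real d - 1) * ln (real d - 1)) * r)"
proof -
  let ?S = "{t :: unit dtree. dary d t \<and> real (tree_size t) \<le> r}"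
  define K where "K = real d * ln (real d) - (real d - 1) * ln (real d - 1)"
  define x where "x = (real d - 1) ^ (d - 1) / real d ^ d"
  have K: "0 \<le> K"
  proof -
    have "(real d - 1) * ln (real d - 1) \<le> real d * ln (real d)"
      using assms by (intro mult_mono) auto
    then show ?thesis by (simp add: K_def)
  qed
  have x: "x = exp (- K)"
  proof -
    have "exp (- K) = exp (ln (real d - 1) * real (d - 1)) / exp (ln (real d) * real d)"
      using assms by (simp add: K_def exp_diff[symmetric] of_nat_diff algebra_simps)
    also have "\<dots> = x"
      using assms by (simp only: exp_of_nat2_mult) (simp add: x_def)
    finally show ?thesis ..
  qed
  have sub: "?S \<subseteq> shapes d (nat \<lfloor>r\<rfloor>)"
    using dary_in_shapes by (auto simp: le_nat_floor)
  then show fin: "finite ?S" using finite_shapes by (rule finite_subset)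
  have "real (card ?S) * exp (- K * r) = (\<Sum>t\<in>?S. exp (- K * r))" by simp
  also have "\<dots> \<le> (\<Sum>t\<in>?S. x ^ tree_size t)"
    using K by (intro sum_mono) (auto simp: x mult_left_mono simp flip: exp_of_nat2_mult)
  also have "\<dots> \<le> (\<Sum>t\<in>shapes d (nat \<lfloor>r\<rfloor>). x ^ tree_size t)"
    using sub finite_shapes by (intro sum_mono2) (auto simp: x)
  also have "\<dots> \<le> real d / (real d - 1)"
    unfolding x_def by (rule sum_shapes_le[OF assms])
  also have "\<dots> \<le> 2" using assms by (simp add: field_simps)
  finally show "real (card ?S) \<le> 2 * exp (K * r)"
    by (simp add: exp_minus field_simps)
qed

lemma sum_list_of_bool_eq: "(\<Sum>u\<leftarrow>xs. of_bool (u = s) :: real) = real (count_list xs s)"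
  by (induction xs) auto

section \<open>The probability of a given shape\<close>

context dary_growth
begin

lemma mean_Suc_eq:
  assumes "dary d s"
  shows "mean (Suc n) (\<lambda>t. of_bool (t = s)) =
    (\<Sum>r\<leftarrow>prunings s. mean n (\<lambda>t. of_bool (t = r))) / slots n"
proof -
  have "mean (Suc n) (\<lambda>t. of_bool (t = s)) =
      mean n (\<lambda>t. (1 / slots n) * (\<Sum>r\<leftarrow>prunings s. of_bool (t = r)))"
    unfolding mean.simps
  proof (rule mean_cong)
    fix t :: "unit dtree" assume "dary d t"
    have "(\<Sum>r\<leftarrow>prunings s. of_bool (t = r)) = real (count_list (prunings s) t)"
      by (subst sum_list_of_bool_eq[symmetric]) (simp add: eq_commute)
    then show "(\<Sum>u\<leftarrow>grow d () t. of_bool (u = s)) / slots n =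
        (1 / slots n) * (\<Sum>r\<leftarrow>prunings s. of_bool (t = r))"
      using \<open>dary d t\<close> assms by (simp add: sum_list_of_bool_eq count_grow_eq_count_prunings)
  qed
  then show ?thesis by (simp only: mean_cmult mean_sum_list) simp
qed

text \<open>Both sides satisfy the same recursion over \<open>prunings\<close>. The numerator is the
  number of increasing labellings of \<open>s\<close>, the denominator the number of increasing
  trees of size \<open>n\<close>.\<close>

lemma mean_eq_hook:
  "dary d s \<Longrightarrow> tree_size s = n \<Longrightarrow>
    mean n (\<lambda>t. of_bool (t = s)) = fact n * hook_weight s / (\<Prod>j<n. slots j)"
proof (induction n arbitrary: s)
  case (Suc n)
  have "(\<Sum>r\<leftarrow>prunings s. mean n (\<lambda>t. of_bool (t = r))) =
      (\<Sum>r\<leftarrow>prunings s. fact n / (\<Prod>j<n. slots j) * hook_weight r)"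
    using prunings_props(1)[of _ s d] Suc
    by (intro arg_cong[where f = sum_list] map_cong refl) simp
  also have "\<dots> = fact n / (\<Prod>j<n. slots j) * (real (Suc n) * hook_weight s)"
    by (simp only: sum_list_const_mult sum_prunings_hook_weight Suc.prems)
  finally show ?case
    by (simp add: mean_Suc_eq[OF Suc.prems(1)] del: mean.simps of_nat_Suc)
qed simp

text \<open>The first factor is \<open>slots 0 = 1\<close>, and the others satisfy
  \<open>slots j \<ge> (d - 1) * j\<close>.\<close>

lemma prod_slots_ge: "(real d - 1) ^ m * fact m \<le> (\<Prod>j<Suc m. slots j)"
proof (induction m)
  case (Suc m)
  have "(real d - 1) ^ Suc m * fact (Suc m) = ((real d - 1) ^ m * fact m) * ((real d - 1) * real (Suc m))"
    by (simp add: algebra_simps)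
  also have "\<dots> \<le> (\<Prod>j<Suc m. slots j) * slots (Suc m)"
    using Suc d_ge_2 by (intro mult_mono prod_nonneg) (auto simp: slots_def less_imp_le)
  finally show ?case by simp
qed (simp add: slots_def)

text \<open>The product of the slots stops at \<open>n - 1\<close>, so a factor
  \<open>(d - 1) * n\<close> remains outside the exponential; the hook weight supplies the sum of
  logarithms.\<close>

lemma mean_eq_le:
  assumes "dary d s" "tree_size s = n" "1 \<le> n"
  shows "mean n (\<lambda>t. of_bool (t = s)) \<le>
    (real d - 1) * real n *
      exp (- (ln (real d - 1) * real n + fringe_sum (\<lambda>u. ln (real (tree_size u))) s))"
proof -
  obtain m where m: "n = Suc m" using assms(3) by (cases n) auto
  define e where "e = real d - 1"
  have e: "e > 0" using d_ge_2 by (simp add: e_def)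
  have h: "0 \<le> hook_weight s" by (simp add: hook_weight_exp)
  have "mean n (\<lambda>t. of_bool (t = s)) = fact n * hook_weight s / (\<Prod>j<n. slots j)"
    using assms by (intro mean_eq_hook) auto
  also have "\<dots> \<le> fact n * hook_weight s / (e ^ m * fact m)"
    using prod_slots_ge[of m] e h unfolding m e_def[symmetric]
    by (intro divide_left_mono mult_nonneg_nonneg mult_pos_pos prod_pos) auto
  also have "\<dots> = e * real n * (hook_weight s / e ^ n)"
    using e by (simp add: m field_simps)
  also have "hook_weight s / e ^ n =
      exp (- (ln e * real n + fringe_sum (\<lambda>u. ln (real (tree_size u))) s))"
    using e by (simp add: hook_weight_exp exp_diff exp_minus exp_of_nat2_mult exp_of_nat_mult field_simps)
  finally show ?thesis by (simp add: e_def)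
qed

end

section \<open>Asymptotics\<close>

lemma pair_sum_nonneg:
  fixes t :: "'a dtree" and ts :: "'a dtree list"
  assumes "\<And>u v. 0 \<le> g u v"
  shows "0 \<le> pair_sum g t" and "0 \<le> pair_sum_list g ts"
  using assms
proof (induction g t and g ts rule: pair_sum_pair_sum_list.induct)
  case (4 g t ts)
  then show ?case by (auto intro!: add_nonneg_nonneg fringe_sum_nonneg sum_list_nonneg)
qed auto

lemma shape_fringe_subtrees: "shape ` fringe_subtrees t = fringe_subtrees (shape t)"
proof (induction t)
  case (Node a ts)
  then have "(\<Union>t\<in>set ts. shape ` fringe_subtrees t) = (\<Union>t\<in>set ts. fringe_subtrees (shape t))" by simp
  then show ?case by (simp add: shape_def image_UN)
qed (simp add: shape_def)

text \<open>Turns limits for each fixed \<open>\<eta>\<close> into one with \<open>\<eta>\<close>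
  tending to 0: at stage \<open>n\<close> it takes \<open>\<eta> = 1 / (m + 1)\<close> for the
  largest \<open>m \<le> n\<close> whose threshold \<open>N m\<close> has been passed, or
  \<open>m = 0\<close> if there is none.\<close>

lemma diagonal_null_sequence:
  fixes a :: "real \<Rightarrow> nat \<Rightarrow> real"
  assumes "\<And>\<eta>. \<eta> > 0 \<Longrightarrow> a \<eta> \<longlonglongrightarrow> 0"
  obtains \<epsilon> where "\<epsilon> \<longlonglongrightarrow> 0" "(\<lambda>n. a (\<epsilon> n) n) \<longlonglongrightarrow> 0"
proof -
  define e where "e m = 1 / real (Suc m)" for m
  have e: "e m > 0" for m by (simp add: e_def)
  have "\<exists>N. \<forall>n\<ge>N. \<bar>a (e m) n\<bar> < e m" for m
    using LIMSEQ_D[OF assms[OF e] e, of m m] by simp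
  then obtain N where N: "\<And>m n. n \<ge> N m \<Longrightarrow> \<bar>a (e m) n\<bar> < e m" by metis
  define S where "S n = insert 0 {m. m \<le> n \<and> N m \<le> n}" for n
  define f where "f n = Max (S n)" for n
  have fin: "finite (S n)" for n by (simp add: S_def)
  have f_ge: "m \<le> f n" if "m \<le> n" "N m \<le> n" for m n
    using that fin by (auto simp: f_def S_def)
  have f_mem: "f n \<in> S n" for n unfolding f_def by (intro Max_in fin) (simp add: S_def)
  have f_lim: "filterlim f at_top sequentially"
    unfolding filterlim_at_top
  proof
    fix m
    show "\<forall>\<^sub>F n in sequentially. m \<le> f n"
      using eventually_ge_at_top[of "max m (N m)"] by eventually_elim (auto intro: f_ge)
  qed
  have e_lim: "e \<longlonglongrightarrow> 0" unfolding e_def by (rule LIMSEQ_Suc[OF lim_1_over_n])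
  then have ef: "(\<lambda>n. e (f n)) \<longlonglongrightarrow> 0" using f_lim by (rule filterlim_compose)
  moreover have "(\<lambda>n. a (e (f n)) n) \<longlonglongrightarrow> 0"
  proof (rule Lim_null_comparison[OF _ ef])
    have "\<forall>\<^sub>F n in sequentially. 1 \<le> f n" using f_lim by (simp add: filterlim_at_top)
    then show "\<forall>\<^sub>F n in sequentially. norm (a (e (f n)) n) \<le> e (f n)"
    proof eventually_elim
      case (elim n)
      then have "N (f n) \<le> n" using f_mem[of n] by (auto simp: S_def)
      then show ?case using N by (simp add: less_imp_le)
    qed
  qed
  ultimately show ?thesis by (rule that)
qed

section \<open>From uniform increasing trees to the growth process\<close>

context dary_growth
begin

text \<open>Every increasing tree of size \<open>n\<close> has \<open>slots n\<close> successors,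
  and these never coincide, so the shape of a uniform tree follows the growth process and the
  product counts the trees.\<close>

lemma sum_dary_increasing_trees:
  "(\<Sum>t\<in>dary_increasing_trees d n. f (shape t)) = (\<Prod>j<n. slots j) * mean n f"
proof (induction n arbitrary: f)
  case 0
  have "dary_increasing_trees d 0 = {Empty}"
    by (auto simp: dary_increasing_trees_def)
  then show ?case by (simp add: shape_def)
next
  case (Suc n)
  have "(\<Sum>s\<leftarrow>grow d (Suc n) t. f (shape s)) = (\<Sum>s\<leftarrow>grow d () (shape t). f s)" for t
  proof -
    have "map shape (grow d (Suc n) t) = grow d () (shape t)"
      unfolding shape_def by (rule map_grow(1))
    then have "sum_list (map f (map shape (grow d (Suc n) t))) = (\<Sum>s\<leftarrow>grow d () (shape t). f s)"
      by simp
    then show ?thesis by (simp add: o_def)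
  qed
  then have "(\<Sum>t\<in>dary_increasing_trees d (Suc n). f (shape t)) =
     (\<Prod>j<n. slots j) * mean n (\<lambda>t. slots n * ((\<Sum>s\<leftarrow>grow d () t. f s) / slots n))"
    using Suc[of "\<lambda>t. \<Sum>s\<leftarrow>grow d () t. f s"] by (simp add: sum_dary_increasing_trees_Suc)
  then show ?case by (simp only: mean_cmult) simp
qed

lemma expectation_random_tree:
  "measure_pmf.expectation (random_tree d n) (\<lambda>t. f (shape t)) = mean n f"
proof -
  have "real (card (dary_increasing_trees d n)) = (\<Prod>j<n. slots j)"
    using sum_dary_increasing_trees[where f = "\<lambda>_. 1"] by simp
  moreover have "(\<Prod>j<n. slots j) \<noteq> 0" by simp
  ultimately show ?thesis
    using d_ge_2 unfolding random_tree_def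
    by (subst integral_pmf_of_set)
       (auto simp: finite_dary_increasing_trees dary_increasing_trees_nonempty sum_dary_increasing_trees)
qed

lemma prob_random_tree:
  "measure_pmf.prob (random_tree d n) {t. P (shape t)} = mean n (\<lambda>s. of_bool (P s))"
proof -
  have "measure_pmf.prob (random_tree d n) {t. P (shape t)} =
      measure_pmf.expectation (random_tree d n) (indicator {t. P (shape t)})"
    by simp
  also have "indicator {t. P (shape t)} = (\<lambda>t. of_bool (P (shape t)) :: real)"
    by (auto simp: indicator_def)
  finally show ?thesis using expectation_random_tree[of n "\<lambda>s. of_bool (P s)"] by simp
qed

text \<open>A first moment argument: \<open>H < c * x\<close> forces the nonnegative error
  \<open>R\<close> above \<open>A - c * x\<close>, which is of order \<open>x\<close>, while its
  mean is \<open>o(x)\<close>. Passing to negatives gives upper bounds as well.\<close>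

lemma lower_bound_transfer:
  fixes A r x :: "nat \<Rightarrow> real"
  assumes bound: "\<forall>\<^sub>F n in sequentially. \<forall>s. dary d s \<and> tree_size s = n \<longrightarrow> A n - R n s \<le> H s"
    and nonneg: "\<And>n s. 0 \<le> R n s"
    and mean_R: "\<forall>\<^sub>F n in sequentially. mean n (R n) \<le> r n"
    and lim_r: "(\<lambda>n. r n / x n) \<longlonglongrightarrow> 0"
    and lim_A: "(\<lambda>n. A n / x n) \<longlonglongrightarrow> a"
    and c: "c < a" and x: "\<forall>\<^sub>F n in sequentially. 0 < x n"
  shows "(\<lambda>n. mean n (\<lambda>s. of_bool (H s < c * x n))) \<longlonglongrightarrow> 0"
    and "\<forall>\<^sub>F n in sequentially. c * x n \<le> mean n H"
proof -
  have ev: "\<forall>\<^sub>F n in sequentially. c < A n / x n"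
    using lim_A c by (rule order_tendstoD)
  have "(\<lambda>n. (r n / x n) / (A n / x n - c)) \<longlonglongrightarrow> 0 / (a - c)"
    using c by (intro tendsto_divide lim_r tendsto_diff lim_A tendsto_const) simp
  then have lim: "(\<lambda>n. (r n / x n) / (A n / x n - c)) \<longlonglongrightarrow> 0" by simp
  show "(\<lambda>n. mean n (\<lambda>s. of_bool (H s < c * x n))) \<longlonglongrightarrow> 0"
  proof (rule tendsto_sandwich[OF _ _ tendsto_const lim])
    show "\<forall>\<^sub>F n in sequentially. 0 \<le> mean n (\<lambda>s. of_bool (H s < c * x n))"
      by (intro always_eventually allI mean_nonneg) simp
    show "\<forall>\<^sub>F n in sequentially. mean n (\<lambda>s. of_bool (H s < c * x n)) \<le>
        (r n / x n) / (A n / x n - c)"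
      using bound mean_R x ev
    proof eventually_elim
      case (elim n)
      define D where "D = A n - c * x n"
      have D: "D > 0" using elim by (simp add: D_def field_simps)
      have "mean n (\<lambda>s. of_bool (H s < c * x n)) \<le> mean n (\<lambda>s. (1 / D) * R n s)"
      proof (rule mean_mono)
        fix s :: "unit dtree" assume "dary d s" "tree_size s = n"
        then have "A n - R n s \<le> H s" using elim by blast
        then have "D \<le> R n s" if "H s < c * x n" using that by (simp add: D_def)
        then show "of_bool (H s < c * x n) \<le> (1 / D) * R n s"
          using D nonneg[of n s] by auto
      qed
      also have "\<dots> \<le> (1 / D) * r n"
        unfolding mean_cmult using elim D by (intro mult_left_mono) auto
      also have "\<dots> = (r n / x n) / (A n / x n - c)"
        using elim D by (simp add: D_def divide_simps)
      finally show ?case .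
    qed
  qed
  have "(\<lambda>n. A n / x n - r n / x n) \<longlonglongrightarrow> a - 0"
    by (intro tendsto_diff lim_A lim_r)
  then have "\<forall>\<^sub>F n in sequentially. c < A n / x n - r n / x n"
    using c by (intro order_tendstoD(1)) auto
  then show "\<forall>\<^sub>F n in sequentially. c * x n \<le> mean n H"
    using bound mean_R x
  proof eventually_elim
    case (elim n)
    have "c * x n \<le> A n - r n" using elim by (simp add: field_simps)
    also have "\<dots> \<le> A n - mean n (R n)" using elim by simp
    also have "\<dots> = mean n (\<lambda>s. A n - R n s)" by (simp add: mean_diff)
    also have "\<dots> \<le> mean n H" using elim by (intro mean_mono) auto
    finally show ?case .
  qed
qed

section \<open>Logarithmic size thresholds\<close>

definition log_index :: "real \<Rightarrow> nat \<Rightarrow> nat" where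
  "log_index r n = nat \<lceil>r * ln (real n)\<rceil>"

lemma log_index_asymp:
  assumes r: "0 < r"
  shows "(\<lambda>n. real (log_index r n) / ln (real n)) \<longlonglongrightarrow> r"
    and "filterlim (log_index r) at_top sequentially"
    and "\<forall>\<^sub>F n in sequentially. log_index r n \<le> n"
proof -
  have bnd: "\<forall>\<^sub>F n in sequentially. r * ln (real n) \<le> real (log_index r n) \<and>
      real (log_index r n) \<le> r * ln (real n) + 1"
    using eventually_ge_at_top[of 1]
  proof eventually_elim
    case (elim n)
    then have "0 \<le> r * ln (real n)" using r by simp
    then show ?case unfolding log_index_def by linarith
  qed
  have ln_pos: "\<forall>\<^sub>F n in sequentially. 0 < ln (real n)"
    by real_asymp
  show "(\<lambda>n. real (log_index r n) / ln (real n)) \<longlonglongrightarrow> r"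
  proof (rule tendsto_sandwich)
    show "\<forall>\<^sub>F n in sequentially. r \<le> real (log_index r n) / ln (real n)"
      using bnd ln_pos by eventually_elim (simp add: field_simps)
    show "\<forall>\<^sub>F n in sequentially. real (log_index r n) / ln (real n) \<le> r + 1 / ln (real n)"
      using bnd ln_pos by eventually_elim (simp add: field_simps)
    show "(\<lambda>n. r + 1 / ln (real n)) \<longlonglongrightarrow> r" by real_asymp
  qed simp
  have "filterlim (\<lambda>n. r * ln (real n)) at_top sequentially" using r by real_asymp
  then have "filterlim (\<lambda>n. real (log_index r n)) at_top sequentially"
    by (rule filterlim_at_top_mono) (use bnd in \<open>eventually_elim, simp\<close>)
  then show "filterlim (log_index r) at_top sequentially"
    unfolding filterlim_at_top by (metis (mono_tags, lifting) eventually_mono of_nat_le_iff)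
  have "\<forall>\<^sub>F n in sequentially. r * ln (real n) + 1 \<le> real n" by real_asymp
  then show "\<forall>\<^sub>F n in sequentially. log_index r n \<le> n"
    using bnd by eventually_elim linarith
qed

lemma mean_fringe_ge_asymp:
  assumes r: "0 < r"
  shows "(\<lambda>n. mean_fringe_ge n (log_index r n) / (real n / ln (real n))) \<longlonglongrightarrow>
    real d / ((real d - 1) * r)"
proof -
  define e where "e = real d - 1"
  have e: "e > 0" using d_ge_2 by (simp add: e_def)
  let ?k = "log_index r"
  have "(\<lambda>n. e * (real (?k n) / ln (real n)) + 1 / ln (real n)) \<longlonglongrightarrow> e * r + 0"
    by (intro tendsto_add tendsto_mult_left log_index_asymp(1)[OF r]) real_asymp
  then have 1: "(\<lambda>n. e * (real (?k n) / ln (real n)) + 1 / ln (real n)) \<longlonglongrightarrow> e * r" by simp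
  have 2: "(\<lambda>n. e + 1 / real n) \<longlonglongrightarrow> e" by real_asymp
  have 3: "(\<lambda>n. ln (real n) / real n) \<longlonglongrightarrow> 0" by real_asymp
  \<comment> \<open>The closed form of the mean, with \<open>slots n\<close> divided by
    \<open>n\<close> and \<open>slots (?k n)\<close> by \<open>ln n\<close>.\<close>
  have "(\<lambda>n. (real d * (e + 1 / real n) / (e * (real (?k n) / ln (real n)) + 1 / ln (real n)) -
      ln (real n) / real n) / e) \<longlonglongrightarrow> (real d * e / (e * r) - 0) / e"
    using e r by (intro tendsto_divide tendsto_diff tendsto_mult tendsto_const 1 2 3) auto
  moreover have "(real d * e / (e * r) - 0) / e = real d / (e * r)" using e r by (simp add: field_simps)
  moreover have "\<forall>\<^sub>F n in sequentially.
      (real d * (e + 1 / real n) / (e * (real (?k n) / ln (real n)) + 1 / ln (real n)) -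
      ln (real n) / real n) / e = mean_fringe_ge n (?k n) / (real n / ln (real n))"
    using log_index_asymp(3)[OF r] eventually_gt_at_top[of 1]
  proof eventually_elim
    case (elim n)
    have ln: "ln (real n) > 0" using elim by simp
    have s: "slots (?k n) > 0" by simp
    have "e * (real (?k n) / ln (real n)) + 1 / ln (real n) = slots (?k n) / ln (real n)"
      by (simp add: slots_def e_def add_divide_distrib)
    moreover have "e + 1 / real n = slots n / real n"
      using elim by (simp add: slots_def e_def add_divide_distrib)
    ultimately show ?case
      using elim ln s e by (simp add: mean_fringe_ge_def e_def[symmetric] field_simps)
  qed
  ultimately show ?thesis
    by (simp add: e_def tendsto_cong)
qed

section \<open>Lower tail of the sum of logarithms\<close>

lemma sum_telescope_ln_le:
  assumes "1 \<le> m"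
  shows "(\<Sum>j=1..<M. (ln (real (Suc j)) - ln (real j)) * of_bool (Suc j \<le> m)) \<le> ln (real m)"
proof -
  let ?c = "\<lambda>j. ln (real (Suc j)) - ln (real j)"
  have "(\<Sum>j=1..<M. ?c j * of_bool (Suc j \<le> m)) =
      (\<Sum>j=1..<M. if j \<in> {j. Suc j \<le> m} then ?c j else 0)"
    by (intro sum.cong) auto
  also have "\<dots> = (\<Sum>j\<in>{1..<M} \<inter> {j. Suc j \<le> m}. ?c j)"
    by (rule sum.inter_restrict[symmetric]) simp
  also have "\<dots> \<le> (\<Sum>j=1..<m. ?c j)"
    by (intro sum_mono2) auto
  also have "\<dots> = ln (real m)"
    using sum_Suc_diff'[of 1 m "\<lambda>j. ln (real j)"] assms by simp
  finally show ?thesis .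
qed

definition log_sum :: "unit dtree \<Rightarrow> real" where
  "log_sum = fringe_sum (\<lambda>u. ln (real (tree_size u)))"

text \<open>Telescopes \<open>ln (tree_size u)\<close> over the levels
  \<open>j < tree_size u\<close> and drops the levels from \<open>M\<close> on, so only finitely
  many counts enter.\<close>

lemma log_sum_ge:
  "(\<Sum>j=1..<M. (ln (real (Suc j)) - ln (real j)) * fringe_ge (Suc j) s) \<le> log_sum s"
proof -
  have "(\<Sum>j=1..<M. (ln (real (Suc j)) - ln (real j)) * fringe_ge (Suc j) s) =
    fringe_sum (\<lambda>u. \<Sum>j=1..<M. (ln (real (Suc j)) - ln (real j)) * of_bool (Suc j \<le> tree_size u)) s"
    by (simp only: fringe_sum_sum fringe_sum_cmult fringe_ge_def)
  also have "\<dots> \<le> log_sum s"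
    unfolding log_sum_def
  proof (rule fringe_sum_mono_fringe)
    fix u assume "u \<in> fringe_subtrees s"
    then have "1 \<le> tree_size u"
      by (induction s) (auto simp: Suc_le_eq)
    then show "(\<Sum>j=1..<M. (ln (real (Suc j)) - ln (real j)) * of_bool (Suc j \<le> tree_size u)) \<le>
        ln (real (tree_size u))"
      by (rule sum_telescope_ln_le)
  qed
  finally show ?thesis .
qed

text \<open>The limit per vertex of the truncated sum in \<open>log_sum_ge\<close>: about
  \<open>d / slots k\<close> of the vertices root a fringe subtree of size at least
  \<open>k\<close>.\<close>

definition truncated_rate :: "nat \<Rightarrow> real" where
  "truncated_rate M = (\<Sum>j=1..<M. (ln (real (Suc j)) - ln (real j)) * (real d / slots (Suc j)))"

text \<open>If \<open>log_sum\<close> falls short, the finitely many counts deviate by an amount of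
  order \<open>k\<close> in total, but their mean absolute deviations are at most
  \<open>sqrt k\<close>; Markov's inequality finishes.\<close>

lemma log_sum_lower_tail:
  assumes "\<nu> < truncated_rate M"
  obtains B where "0 \<le> B"
    "\<And>k. 1 \<le> k \<Longrightarrow> mean k (\<lambda>s. of_bool (log_sum s < \<nu> * real k)) \<le> B / sqrt (real k)"
proof -
  define c where "c j = ln (real (Suc j)) - ln (real j)" for j
  have c: "0 \<le> c j" if "1 \<le> j" for j using that by (simp add: c_def)
  have rate: "truncated_rate M = (\<Sum>j=1..<M. c j * (real d / slots (Suc j)))"
    by (simp only: truncated_rate_def c_def)
  define C where "C = (\<Sum>j=1..<M. c j)"
  have C: "0 \<le> C" unfolding C_def by (intro sum_nonneg c) simp
  define \<delta> where "\<delta> = truncated_rate M - \<nu>"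
  have \<delta>: "\<delta> > 0" using assms by (simp add: \<delta>_def)
  have "mean k (\<lambda>s. of_bool (log_sum s < \<nu> * real k)) \<le> 3 * C / \<delta> / sqrt (real k)"
    if k: "1 \<le> k" for k
  proof -
    let ?D = "\<lambda>s. \<Sum>j=1..<M. c j * \<bar>fringe_ge (Suc j) s - mean_fringe_ge k (Suc j)\<bar>"
    \<comment> \<open>The constant 2 covers both the bounded correction in the closed form and the
      sizes \<open>j > k\<close>, where the mean is 0 but
      \<open>d * k \<le> 2 * slots j\<close>.\<close>
    have z: "real d / slots j * real k - 2 \<le> mean_fringe_ge k j" for j
    proof (cases "j \<le> k")
      case True
      define e where "e = real d - 1"
      have e: "e \<ge> 1" "real d = e + 1" using d_ge_2 by (auto simp: e_def)
      have "mean_fringe_ge k j - real d / slots j * real k = (real d / slots j - 1) / e"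
        using True e(1) by (simp add: mean_fringe_ge_def slots_def[of k] flip: e_def) (simp add: field_simps)
      also have "\<dots> \<ge> - 1 / e" using e by (intro divide_right_mono) (auto simp: less_imp_le)
      finally have "- 1 / e \<le> mean_fringe_ge k j - real d / slots j * real k" .
      moreover have "- 1 \<le> - 1 / e" using e by simp
      ultimately show ?thesis by linarith
    next
      case False
      have "real d * real k \<le> 2 * slots j"
      proof -
        have "real d * real k \<le> 2 * ((real d - 1) * real k)"
          using d_ge_2 mult_right_mono[of 2 "real d" "real k"] by (simp add: algebra_simps)
        also have "\<dots> \<le> 2 * slots k" by (simp add: slots_def)
        also have "\<dots> \<le> 2 * slots j" using slots_mono[of k j] False by simp
        finally show ?thesis .
      qed
      then show ?thesis using False by (simp add: mean_fringe_ge_def field_simps)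
    qed
    have bad: "of_bool (log_sum s < \<nu> * real k) \<le> (1 / (real k * \<delta>)) * (?D s + 2 * C)"
      if "dary d s" for s
    proof -
      have "0 \<le> ?D s" using c by (intro sum_nonneg) auto
      moreover have "real k * \<delta> \<le> ?D s + 2 * C" if "log_sum s < \<nu> * real k"
      proof -
        have "truncated_rate M * real k - 2 * C - ?D s =
            (\<Sum>j=1..<M. c j * (real d / slots (Suc j) * real k - 2 -
               \<bar>fringe_ge (Suc j) s - mean_fringe_ge k (Suc j)\<bar>))"
          by (simp add: rate C_def sum_distrib_left sum_distrib_right right_diff_distrib
              sum_subtractf mult_ac)
        also have "\<dots> \<le> (\<Sum>j=1..<M. c j * fringe_ge (Suc j) s)"
        proof (rule sum_mono)
          fix j assume "j \<in> {1..<M}"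
          then show "c j * (real d / slots (Suc j) * real k - 2 -
               \<bar>fringe_ge (Suc j) s - mean_fringe_ge k (Suc j)\<bar>) \<le> c j * fringe_ge (Suc j) s"
            using z[of "Suc j"] c by (intro mult_left_mono) auto
        qed
        also have "\<dots> \<le> log_sum s" unfolding c_def by (rule log_sum_ge)
        finally show ?thesis using that by (simp add: \<delta>_def algebra_simps)
      qed
      ultimately show ?thesis using k \<delta> C by auto
    qed
    have "mean k (\<lambda>s. of_bool (log_sum s < \<nu> * real k)) \<le>
        mean k (\<lambda>s. (1 / (real k * \<delta>)) * (?D s + 2 * C))"
      by (rule mean_mono) (rule bad)
    also have "\<dots> = (1 / (real k * \<delta>)) *
        ((\<Sum>j=1..<M. c j * mean k (\<lambda>s. \<bar>fringe_ge (Suc j) s - mean_fringe_ge k (Suc j)\<bar>)) + 2 * C)"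
      by (simp only: mean_cmult mean_add mean_const mean_sum)
    also have "\<dots> \<le> (1 / (real k * \<delta>)) * ((\<Sum>j=1..<M. c j * sqrt (real k)) + 2 * C)"
      using k \<delta> c fringe_ge_deviation[of _ k]
      by (intro mult_left_mono add_mono sum_mono order.refl) auto
    also have "\<dots> = (1 / (real k * \<delta>)) * (C * sqrt (real k) + 2 * C)"
      by (simp add: C_def sum_distrib_right)
    also have "\<dots> \<le> (1 / (real k * \<delta>)) * (C * sqrt (real k) + 2 * (C * sqrt (real k)))"
      using k \<delta> C by (intro mult_left_mono add_mono order.refl) (auto simp: mult_le_cancel_left1)
    also have "\<dots> = 3 * C / \<delta> / sqrt (real k)"
      using k \<delta> by (simp add: field_simps)
    finally show ?thesis .
  qed
  then show ?thesis using that[of "3 * C / \<delta>"] C \<delta> by simp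
qed

text \<open>Summation by parts turns the partial sums in \<open>c_lower\<close> into sums with nonnegative weights on the
  counts \<open>fringe_ge\<close>, up to a boundary term of favourable sign.\<close>

lemma truncated_rate_ge:
  "(\<Sum>k=1..M. real d * (real d - 1) *
      (ln (real k) / (((real d - 1) * real k + real d) * ((real d - 1) * real k + 1))))
     \<le> truncated_rate M"
proof -
  let ?f = "\<lambda>k. real d * (real d - 1) *
      (ln (real k) / (((real d - 1) * real k + real d) * ((real d - 1) * real k + 1)))"
  \<comment> \<open>Partial fractions: the two denominators are consecutive values of
    \<open>slots\<close>, which differ by \<open>d - 1\<close>.\<close>
  have f: "?f k = (real d / slots k - real d / slots (Suc k)) * ln (real k)" for k
  proof -
    have s: "(real d - 1) * real k + real d = slots (Suc k)" "(real d - 1) * real k + 1 = slots k"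
      by (simp_all add: slots_def algebra_simps)
    have a: "real d - 1 = slots (Suc k) - slots k" by (simp add: slots_def algebra_simps)
    show ?thesis unfolding s unfolding a by (simp add: field_simps)
  qed
  have "(\<Sum>k=1..M. (real d / slots k - real d / slots (Suc k)) * ln (real k)) =
      truncated_rate M - real d / slots (Suc M) * ln (real M)"
  proof (induction M)
    case 0
    then show ?case by (simp add: truncated_rate_def)
  next
    case (Suc M)
    have "truncated_rate (Suc M) = truncated_rate M +
        (ln (real (Suc M)) - ln (real M)) * (real d / slots (Suc M))" if "M \<ge> 1"
      using that by (simp add: truncated_rate_def)
    moreover have "truncated_rate (Suc 0) = 0" by (simp add: truncated_rate_def)
    ultimately show ?case
      using Suc by (cases M) (simp_all add: algebra_simps)
  qed
  then have "(\<Sum>k=1..M. ?f k) = truncated_rate M - real d / slots (Suc M) * ln (real M)"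
    by (simp only: f)
  moreover have "0 \<le> real d / slots (Suc M) * ln (real M)"
    by (cases M) (auto intro!: mult_nonneg_nonneg divide_nonneg_pos)
  ultimately show ?thesis by linarith
qed

text \<open>The bound on \<open>\<mu>\<close> equals \<open>ln (d - 1) + q * I\<close>, where
  \<open>I\<close> is the series in \<open>c_lower\<close>; \<open>q\<close> times its partial sums
  is dominated by truncated rates.\<close>

lemma truncated_rate_approx:
  assumes "\<mu> < (real d - 1) / real d * c_lower d"
  obtains M where "\<mu> < ln (real d - 1) + truncated_rate M"
proof -
  let ?f = "\<lambda>k::nat. ln (real k) / (((real d - 1) * real k + real d) * ((real d - 1) * real k + 1))"
  define I where "I = (\<Sum>\<^sub>\<infinity>k\<in>{1::nat..}. ?f k)"
  define q where "q = real d * (real d - 1)"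
  have q: "q > 0" using d_ge_2 by (simp add: q_def)
  have f_nonneg: "0 \<le> ?f k" for k
    using d_ge_2 by (cases k) auto
  have "(real d - 1) / real d * c_lower d = ln (real d - 1) + q * I"
    using d_ge_2 by (simp add: c_lower_def I_def q_def field_simps power2_eq_square)
  then have \<mu>: "\<mu> < ln (real d - 1) + q * I" using assms by simp
  define \<epsilon> where "\<epsilon> = (ln (real d - 1) + q * I - \<mu>) / (2 * q)"
  have \<epsilon>: "\<epsilon> > 0" using \<mu> q by (simp add: \<epsilon>_def)
  have "\<exists>M. I - \<epsilon> \<le> (\<Sum>k=1..M. ?f k)"
  proof (cases "?f summable_on {1..}")
    case True
    then have "(?f has_sum I) {1..}" unfolding I_def by (rule has_sum_infsum)
    from has_sum_finite_approximation[OF this \<epsilon>]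
    obtain F where F: "finite F" "F \<subseteq> {1..}" "dist (sum ?f F) I \<le> \<epsilon>" by blast
    have "sum ?f F \<le> (\<Sum>k=1..Max (insert 1 F). ?f k)"
      using F f_nonneg by (intro sum_mono2) auto
    then show ?thesis using F(3) by (intro exI[of _ "Max (insert 1 F)"]) (auto simp: dist_real_def)
  next
    case False
    \<comment> \<open>An infinite sum defaults to 0 without summability, and then the empty partial
      sum suffices.\<close>
    then have "I = 0" unfolding I_def by (rule infsum_not_exists)
    then show ?thesis using \<epsilon> by (intro exI[of _ 0]) simp
  qed
  then obtain M where M: "I - \<epsilon> \<le> (\<Sum>k=1..M. ?f k)" by blast
  have "q * (I - \<epsilon>) \<le> q * (\<Sum>k=1..M. ?f k)" using M q by (intro mult_left_mono) auto
  also have "\<dots> \<le> truncated_rate M"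
    using truncated_rate_ge[of M] by (simp add: q_def sum_distrib_left)
  finally have "q * I - q * \<epsilon> \<le> truncated_rate M" by (simp add: right_diff_distrib)
  moreover have "q * \<epsilon> = (ln (real d - 1) + q * I - \<mu>) / 2" using q by (simp add: \<epsilon>_def)
  ultimately have "\<mu> < ln (real d - 1) + truncated_rate M" using \<mu> by argo
  then show ?thesis by (rule that)
qed

section \<open>Bounds with fixed constants\<close>

definition distinct_fringe :: "unit dtree \<Rightarrow> real" where
  "distinct_fringe s = real (card (fringe_subtrees s))"

lemma mean_fringe_ge_le:
  assumes "1 \<le> k" "1 \<le> n"
  shows "mean n (fringe_ge k) \<le> mean_fringe_ge n k + sqrt (real n)"
proof -
  have "mean n (fringe_ge k) \<le> mean n (\<lambda>s. mean_fringe_ge n k + \<bar>fringe_ge k s - mean_fringe_ge n k\<bar>)"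
    by (rule mean_mono) simp
  then show ?thesis
    using fringe_ge_deviation[OF assms] by (simp only: mean_add mean_const)
qed

text \<open>The threshold is about \<open>r * ln n\<close> with
  \<open>d / ((d - 1) * c) < r < 1 / L\<close>. The upper end leaves
  \<open>O(n^(L * r)) = o(n / ln n)\<close> small shapes; the lower end keeps the large fringe
  subtrees below \<open>c * n / ln n\<close>.\<close>

lemma upper_bound_rate:
  assumes "c_upper d < c"
  shows "(\<lambda>n. mean n (\<lambda>s. of_bool (c * (real n / ln (real n)) < distinct_fringe s))) \<longlonglongrightarrow> 0"
    and "\<forall>\<^sub>F n in sequentially. mean n distinct_fringe \<le> c * (real n / ln (real n))"
proof -
  define L where "L = real d * ln (real d) - (real d - 1) * ln (real d - 1)"
  have L: "L > 0"
  proof -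
    have "(real d - 1) * ln (real d - 1) \<le> (real d - 1) * ln (real d)"
      using d_ge_2 by (intro mult_left_mono) auto
    also have "\<dots> < real d * ln (real d)" using d_ge_2 by simp
    finally show ?thesis by (simp add: L_def)
  qed
  have cU: "c_upper d = real d / (real d - 1) * L" by (simp add: c_upper_def L_def)
  have d1: "real d / (real d - 1) > 0" using d_ge_2 by simp
  have c: "c > 0" using assms d1 L unfolding cU by (meson mult_pos_pos less_trans)
  have "u / c < 1 / L" if "u * L < c" for u
    using that c L by (simp add: field_simps)
  then have "real d / (real d - 1) / c < 1 / L"
    using assms unfolding cU .
  then obtain r where r: "real d / (real d - 1) / c < r" "r < 1 / L" using dense by blast
  have r0: "r > 0" using r(1) d1 c by (meson divide_pos_pos less_trans)
  have rL: "L * r < 1" using r(2) L by (simp add: field_simps)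
  have lim_c: "real d / ((real d - 1) * r) < c"
    using r(1) r0 c d_ge_2 by (simp add: field_simps)
  let ?k = "log_index r" and ?x = "\<lambda>n::nat. real n / ln (real n)"
  define S where "S n = 2 * exp (L * (r * ln (real n)))" for n :: nat
  define R where "R n s = \<bar>fringe_ge (?k n) s - mean_fringe_ge n (?k n)\<bar> + S n" for n s
  define q where "q n = sqrt (real n) + S n" for n
  have ge1: "\<forall>\<^sub>F n in sequentially. 1 \<le> ?k n"
    using log_index_asymp(2)[OF r0] by (simp add: filterlim_at_top)
  have "distinct_fringe s \<le> fringe_ge (?k n) s + S n" if "dary d s" for s n
  proof -
    let ?T = "{t :: unit dtree. dary d t \<and> real (tree_size t) \<le> r * ln (real n)}"
    have small: "real (tree_size u) \<le> r * ln (real n)" if "\<not> ?k n \<le> tree_size u" for u :: "unit dtree"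
      using that unfolding log_index_def by linarith
    have "fringe_subtrees s \<subseteq> ?T \<union> (fringe_subtrees s \<inter> {u. ?k n \<le> tree_size u})"
      using fringe_subtrees_dary[OF that] small by auto
    then have "card (fringe_subtrees s) \<le> card (?T \<union> (fringe_subtrees s \<inter> {u. ?k n \<le> tree_size u}))"
      using card_shapes_le(1)[OF d_ge_2] by (intro card_mono) auto
    also have "\<dots> \<le> card ?T + card (fringe_subtrees s \<inter> {u. ?k n \<le> tree_size u})"
      by (rule card_Un_le)
    finally have "distinct_fringe s \<le> real (card ?T) + real (card (fringe_subtrees s \<inter> {u. ?k n \<le> tree_size u}))"
      by (simp add: distinct_fringe_def)
    also have "real (card ?T) \<le> S n"
      using card_shapes_le(2)[OF d_ge_2] by (simp add: S_def L_def)
    also have "real (card (fringe_subtrees s \<inter> {u. ?k n \<le> tree_size u})) \<le> fringe_ge (?k n) s"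
      using card_fringe_le[of s "{u. ?k n \<le> tree_size u}"] by (simp add: fringe_ge_def)
    finally show ?thesis by simp
  qed
  \<comment> \<open>Signs are reversed to fit the form of
    \<open>lower_bound_transfer\<close>.\<close>
  then have bound: "- mean_fringe_ge n (?k n) - R n s \<le> - distinct_fringe s" if "dary d s" for s n
    using that unfolding R_def by (smt (verit) abs_ge_self)
  have ev_R: "\<forall>\<^sub>F n in sequentially. mean n (R n) \<le> q n"
    using ge1 eventually_ge_at_top[of 1]
  proof eventually_elim
    case (elim n)
    then show ?case unfolding R_def q_def mean_add mean_const
      using fringe_ge_deviation[of "?k n" n] by simp
  qed
  have lim_q: "(\<lambda>n. q n / ?x n) \<longlonglongrightarrow> 0"
  proof -
    have "(\<lambda>n. sqrt (real n) / ?x n) \<longlonglongrightarrow> 0" by real_asymp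
    moreover have "(\<lambda>n. S n / ?x n) \<longlonglongrightarrow> 0"
    proof -
      define b where "b = L * r"
      have "b < 1" using rL by (simp add: b_def)
      then have "(\<lambda>n. 2 * exp (b * ln (real n)) / (real n / ln (real n))) \<longlonglongrightarrow> 0" by real_asymp
      then show ?thesis by (simp add: S_def b_def mult.assoc)
    qed
    ultimately have "(\<lambda>n. sqrt (real n) / ?x n + S n / ?x n) \<longlonglongrightarrow> 0 + 0" by (rule tendsto_add)
    then show ?thesis unfolding q_def add_divide_distrib by simp
  qed
  have lim_A: "(\<lambda>n. - mean_fringe_ge n (?k n) / ?x n) \<longlonglongrightarrow> - (real d / ((real d - 1) * r))"
    using tendsto_minus[OF mean_fringe_ge_asymp[OF r0]] by simp
  have ev_bound: "\<forall>\<^sub>F n in sequentially. \<forall>s. dary d s \<and> tree_size s = n \<longrightarrow>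
      - mean_fringe_ge n (?k n) - R n s \<le> - distinct_fringe s"
    using bound by simp
  have c_less: "- c < - (real d / ((real d - 1) * r))" using lim_c by simp
  have x: "\<forall>\<^sub>F n in sequentially. 0 < ?x n" by real_asymp
  have R: "0 \<le> R n s" for n s by (simp add: R_def S_def)
  note transfer = lower_bound_transfer[OF ev_bound R ev_R lim_q lim_A c_less x]
  show "(\<lambda>n. mean n (\<lambda>s. of_bool (c * ?x n < distinct_fringe s))) \<longlonglongrightarrow> 0"
    "\<forall>\<^sub>F n in sequentially. mean n distinct_fringe \<le> c * ?x n"
    using transfer mean_cmult[of _ "- 1" distinct_fringe] by simp_all
qed

text \<open>Counts the large fringe subtrees minus the atypical ones and the coincidences among the
  typical ones; both losses are of smaller order.\<close>

lemma lower_bound_rate: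
  assumes "0 < c_lower d" "c < c_lower d"
  shows "(\<lambda>n. mean n (\<lambda>s. of_bool (distinct_fringe s < c * (real n / ln (real n))))) \<longlonglongrightarrow> 0"
    and "\<forall>\<^sub>F n in sequentially. c * (real n / ln (real n)) \<le> mean n distinct_fringe"
proof -
  define e where "e = real d - 1"
  have e: "e > 0" "real d > 0" using d_ge_2 by (auto simp: e_def)
  \<comment> \<open>Three nested rates are chosen: \<open>\<mu>\<close> sets the threshold
    \<open>ln n / \<mu>\<close> and exceeds \<open>(d - 1) / d * c\<close>;
    \<open>\<mu>1 > \<mu>\<close> beats the \<open>n^2\<close> pairs; the gap from
    \<open>\<mu>1\<close> to \<open>\<mu>2\<close> absorbs the polynomial factor of
    \<open>mean_eq_le\<close>. The maximum with 0 makes the threshold positive.\<close>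
  have "max 0 (e / real d * c) < e / real d * c_lower d"
    using assms e by (auto simp: divide_strict_right_mono)
  then obtain \<mu> where \<mu>: "max 0 (e / real d * c) < \<mu>" "\<mu> < e / real d * c_lower d"
    using dense by blast
  then obtain \<mu>1 where \<mu>1: "\<mu> < \<mu>1" "\<mu>1 < e / real d * c_lower d" using dense by blast
  then obtain \<mu>2 where \<mu>2: "\<mu>1 < \<mu>2" "\<mu>2 < e / real d * c_lower d" using dense by blast
  have \<mu>_pos: "\<mu> > 0" and c_less: "c < real d / (e * (1 / \<mu>))"
    using \<mu>(1) e by (auto simp: field_simps)
  obtain M where M: "\<mu>2 < ln e + truncated_rate M"
    using truncated_rate_approx[of \<mu>2] \<mu>2(2) unfolding e_def by blast
  define \<nu> where "\<nu> = \<mu>2 - ln e"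
  have "\<nu> < truncated_rate M" using M by (simp add: \<nu>_def)
  from log_sum_lower_tail[OF this] obtain B where B: "0 \<le> B"
    "\<And>k. 1 \<le> k \<Longrightarrow> mean k (\<lambda>s. of_bool (log_sum s < \<nu> * real k)) \<le> B / sqrt (real k)"
    by blast
  have "\<forall>\<^sub>F k in sequentially. e * real k \<le> exp ((\<mu>2 - \<mu>1) * real k)"
    using \<mu>2(1) e by real_asymp
  then obtain K where K: "\<And>k. k \<ge> K \<Longrightarrow> e * real k \<le> exp ((\<mu>2 - \<mu>1) * real k)"
    by (auto simp: eventually_sequentially)
  let ?k = "log_index (1 / \<mu>)" and ?x = "\<lambda>n::nat. real n / ln (real n)"
  have r0: "0 < 1 / \<mu>" using \<mu>_pos by simp
  \<comment> \<open>Large trees are split by whether \<open>log_sum\<close> reaches its typical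
    value; \<open>g\<close> detects coincidences of good trees only.\<close>
  define good where "good n = {u. ?k n \<le> tree_size u \<and> \<nu> * real (tree_size u) \<le> log_sum u}" for n
  define bad where "bad n = {u. ?k n \<le> tree_size u \<and> log_sum u < \<nu> * real (tree_size u)}" for n
  define g where "g n u v = (of_bool (u = v \<and> u \<in> good n) :: real)" for n u v
  define R where "R n s = \<bar>fringe_ge (?k n) s - mean_fringe_ge n (?k n)\<bar> +
      (fringe_sum (\<lambda>u. of_bool (u \<in> bad n)) s + pair_sum (g n) s)" for n s
  define q where "q n = sqrt (real n) + (B / sqrt (real (?k n)) * (mean_fringe_ge n (?k n) + sqrt (real n)) +
      exp (- (\<mu>1 * real (?k n))) * (real n)\<^sup>2)" for n
  have bound: "mean_fringe_ge n (?k n) - R n s \<le> distinct_fringe s" for n s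
  proof -
    have "fringe_sum (\<lambda>u. of_bool (u \<in> good n)) s - pair_sum (g n) s \<le> real (card (fringe_subtrees s \<inter> good n))"
      using card_fringe_ge(1)[of "good n" s] by (simp add: g_def[abs_def])
    also have "\<dots> \<le> distinct_fringe s"
      unfolding distinct_fringe_def by (simp add: card_mono)
    finally have "fringe_sum (\<lambda>u. of_bool (u \<in> good n)) s - pair_sum (g n) s \<le> distinct_fringe s" .
    moreover have "fringe_ge (?k n) s =
        fringe_sum (\<lambda>u. of_bool (u \<in> good n)) s + fringe_sum (\<lambda>u. of_bool (u \<in> bad n)) s"
      unfolding fringe_ge_def fringe_sum_add[symmetric]
      by (intro arg_cong[where f = "\<lambda>f. fringe_sum f s"] ext) (auto simp: good_def bad_def)
    ultimately show ?thesis unfolding R_def by linarith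
  qed
  have ge1: "\<forall>\<^sub>F n in sequentially. max 1 K \<le> ?k n"
    using log_index_asymp(2)[OF r0] unfolding filterlim_at_top by blast
  have mean_R: "mean n (R n) \<le> q n" if k: "max 1 K \<le> ?k n" and n: "1 \<le> n" for n
  proof -
    have "mean n (\<lambda>s. \<bar>fringe_ge (?k n) s - mean_fringe_ge n (?k n)\<bar>) \<le> sqrt (real n)"
      using k n by (intro fringe_ge_deviation) auto
    moreover have "mean n (fringe_sum (\<lambda>u. of_bool (u \<in> bad n))) \<le>
        B / sqrt (real (?k n)) * (mean_fringe_ge n (?k n) + sqrt (real n))"
    proof -
      \<comment> \<open>Averaging over trees of equal size turns badness into the tail probability
        of \<open>log_sum\<close>, which is largest at the threshold size.\<close>
      have avg_bad: "avg (\<lambda>u. of_bool (u \<in> bad n)) u \<le> B / sqrt (real (?k n)) * of_bool (?k n \<le> tree_size u)" for u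
      proof (cases "?k n \<le> tree_size u")
        case True
        have "avg (\<lambda>u. of_bool (u \<in> bad n)) u =
            mean (tree_size u) (\<lambda>s. of_bool (log_sum s < \<nu> * real (tree_size u)))"
          unfolding avg_def using True by (intro mean_cong) (auto simp: bad_def)
        also have "\<dots> \<le> B / sqrt (real (tree_size u))" using True k by (intro B(2)) auto
        also have "\<dots> \<le> B / sqrt (real (?k n))"
          using True k B(1) by (intro divide_left_mono mult_pos_pos) auto
        finally show ?thesis using True by simp
      next
        case False
        have "avg (\<lambda>u. of_bool (u \<in> bad n)) u = mean (tree_size u) (\<lambda>s. 0)"
          unfolding avg_def using False by (intro mean_cong) (auto simp: bad_def)
        then show ?thesis using False by simp
      qed
      have "mean n (fringe_sum (\<lambda>u. of_bool (u \<in> bad n))) \<le>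
          mean n (\<lambda>s. B / sqrt (real (?k n)) * fringe_ge (?k n) s)"
        unfolding mean_fringe_sum_avg[of n "\<lambda>u. of_bool (u \<in> bad n)"] fringe_ge_def fringe_sum_cmult[symmetric]
        by (intro mean_mono fringe_sum_mono_fringe avg_bad)
      also have "\<dots> \<le> B / sqrt (real (?k n)) * (mean_fringe_ge n (?k n) + sqrt (real n))"
        unfolding mean_cmult using k n B(1) by (intro mult_left_mono mean_fringe_ge_le) auto
      finally show ?thesis .
    qed
    moreover have "mean n (pair_sum (g n)) \<le> exp (- (\<mu>1 * real (?k n))) * (real n)\<^sup>2"
    proof (rule mean_pair_sum_le)
      fix u v :: "unit dtree"
      let ?E = "exp (- (\<mu>1 * real (?k n)))"
      \<comment> \<open>For a fixed good \<open>w\<close> of the right size, a coincidence means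
        that the random tree has shape \<open>w\<close>, so the shape probability bounds it.\<close>
      have "mean (tree_size v) (g n w) \<le> ?E" if w: "dary d w" for w
      proof (cases "w \<in> good n \<and> tree_size w = tree_size v")
        case True
        let ?l = "tree_size v"
        have l: "?k n \<le> ?l" "\<nu> * real ?l \<le> log_sum w" using True by (auto simp: good_def)
        have "mean ?l (g n w) = mean ?l (\<lambda>t. of_bool (t = w))"
          using True by (intro mean_cong) (auto simp: g_def)
        also have "\<dots> \<le> e * real ?l * exp (- (ln e * real ?l + log_sum w))"
          using mean_eq_le[OF w, of ?l] True l k by (simp add: e_def log_sum_def)
        also have "\<dots> \<le> e * real ?l * exp (- (\<mu>2 * real ?l))"
          using l(2) e by (intro mult_left_mono) (auto simp: \<nu>_def algebra_simps)
        also have "\<dots> \<le> exp ((\<mu>2 - \<mu>1) * real ?l) * exp (- (\<mu>2 * real ?l))"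
          using l k by (intro mult_right_mono K) auto
        also have "\<dots> = exp (- (\<mu>1 * real ?l))"
          by (simp add: exp_add[symmetric] algebra_simps)
        also have "\<dots> \<le> ?E" using l \<mu>1(1) \<mu>_pos by simp
        finally show ?thesis .
      next
        case False
        have "mean (tree_size v) (g n w) = mean (tree_size v) (\<lambda>_. 0)"
          using False by (intro mean_cong) (auto simp: g_def)
        then show ?thesis by simp
      qed
      then have "avg2 (g n) u v \<le> mean (tree_size u) (\<lambda>_. ?E)"
        unfolding avg2_def by (intro mean_mono)
      then show "avg2 (g n) u v \<le> ?E" by simp
    qed simp
    ultimately show ?thesis unfolding R_def q_def mean_add by linarith
  qed
  have lim_q: "(\<lambda>n. q n / ?x n) \<longlonglongrightarrow> 0"
  proof -
    have sq: "(\<lambda>n. sqrt (real n) / ?x n) \<longlonglongrightarrow> 0" by real_asymp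
    have "filterlim (\<lambda>n. sqrt (real (?k n))) at_top sequentially"
      by (intro filterlim_compose[OF sqrt_at_top] filterlim_compose[OF filterlim_real_sequentially]
          log_index_asymp(2)[OF r0])
    then have "(\<lambda>n. B / sqrt (real (?k n))) \<longlonglongrightarrow> 0"
      by (intro tendsto_divide_0[OF tendsto_const] filterlim_at_top_imp_at_infinity)
    then have "(\<lambda>n. B / sqrt (real (?k n)) * (mean_fringe_ge n (?k n) / ?x n + sqrt (real n) / ?x n)) \<longlonglongrightarrow>
        0 * (real d / ((real d - 1) * (1 / \<mu>)) + 0)"
      by (intro tendsto_mult tendsto_add mean_fringe_ge_asymp[OF r0] sq)
    then have 2: "(\<lambda>n. B / sqrt (real (?k n)) * (mean_fringe_ge n (?k n) / ?x n + sqrt (real n) / ?x n)) \<longlonglongrightarrow> 0"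
      by simp
    have 3: "(\<lambda>n. exp (- (\<mu>1 * real (?k n))) * (real n)\<^sup>2 / ?x n) \<longlonglongrightarrow> 0"
    proof (rule tendsto_sandwich[OF _ _ tendsto_const])
      \<comment> \<open>Since \<open>\<rho> > 1\<close>, the coincidences contribute at most
        \<open>n^(2 - \<rho>) = o(n / ln n)\<close>.\<close>
      define \<rho> where "\<rho> = \<mu>1 / \<mu>"
      have \<rho>: "\<rho> > 1" using \<mu>1(1) \<mu>_pos by (simp add: \<rho>_def)
      show "\<forall>\<^sub>F n in sequentially. 0 \<le> exp (- (\<mu>1 * real (?k n))) * (real n)\<^sup>2 / ?x n"
        using eventually_ge_at_top[of 1] by eventually_elim simp
      show "\<forall>\<^sub>F n in sequentially. exp (- (\<mu>1 * real (?k n))) * (real n)\<^sup>2 / ?x n \<le>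
          exp (- (\<rho> * ln (real n))) * (real n)\<^sup>2 / ?x n"
        using eventually_ge_at_top[of 1]
      proof eventually_elim
        case (elim n)
        have "ln (real n) / \<mu> \<le> real (?k n)" unfolding log_index_def by (simp add: real_nat_ceiling_ge)
        then have "\<rho> * ln (real n) \<le> \<mu>1 * real (?k n)"
          using \<mu>1(1) \<mu>_pos mult_left_mono[of "ln (real n) / \<mu>" "real (?k n)" \<mu>1] by (simp add: \<rho>_def)
        then show ?case using elim by (intro divide_right_mono mult_right_mono) auto
      qed
      show "(\<lambda>n. exp (- (\<rho> * ln (real n))) * (real n)\<^sup>2 / ?x n) \<longlonglongrightarrow> 0"
        using \<rho> by real_asymp
    qed
    have "(\<lambda>n. sqrt (real n) / ?x n +
        (B / sqrt (real (?k n)) * (mean_fringe_ge n (?k n) / ?x n + sqrt (real n) / ?x n) +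
         exp (- (\<mu>1 * real (?k n))) * (real n)\<^sup>2 / ?x n)) \<longlonglongrightarrow> 0 + (0 + 0)"
      by (intro tendsto_add sq 2 3)
    then show ?thesis
      unfolding q_def add_divide_distrib times_divide_eq_right[symmetric] by simp
  qed
  have ev_R: "\<forall>\<^sub>F n in sequentially. mean n (R n) \<le> q n"
    using ge1 eventually_ge_at_top[of 1] by eventually_elim (rule mean_R)
  have x: "\<forall>\<^sub>F n in sequentially. 0 < ?x n" by real_asymp
  have R: "0 \<le> R n s" for n s
    unfolding R_def by (intro add_nonneg_nonneg fringe_sum_nonneg pair_sum_nonneg) (auto simp: g_def)
  have ev_bound: "\<forall>\<^sub>F n in sequentially. \<forall>s. dary d s \<and> tree_size s = n \<longrightarrow>
      mean_fringe_ge n (?k n) - R n s \<le> distinct_fringe s"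
    using bound by simp
  show "(\<lambda>n. mean n (\<lambda>s. of_bool (distinct_fringe s < c * ?x n))) \<longlonglongrightarrow> 0"
    and "\<forall>\<^sub>F n in sequentially. c * ?x n \<le> mean n distinct_fringe"
    using lower_bound_transfer[OF ev_bound R ev_R lim_q mean_fringe_ge_asymp[OF r0] _ x] c_less
    by (simp_all add: e_def)
qed

section \<open>From fixed constants to vanishing error terms\<close>

lemma upper_limits:
  obtains \<delta> \<delta>' where "\<delta> \<longlonglongrightarrow> 0" "\<delta>' \<longlonglongrightarrow> 0"
    "\<forall>\<^sub>F n in sequentially. mean n distinct_fringe \<le> c_upper d * real n / ln (real n) * (1 + \<delta> n)"
    "(\<lambda>n. mean n (\<lambda>s. of_bool
       (c_upper d * real n / ln (real n) * (1 + \<delta>' n) < distinct_fringe s))) \<longlonglongrightarrow> 0"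
proof -
  have pos: "0 < c_upper d"
  proof -
    have "(real d - 1) * ln (real d - 1) \<le> (real d - 1) * ln (real d)"
      using d_ge_2 by (intro mult_left_mono) auto
    also have "\<dots> < real d * ln (real d)" using d_ge_2 by simp
    finally show ?thesis using d_ge_2 by (simp add: c_upper_def)
  qed
  let ?b = "\<lambda>\<eta> n. c_upper d * real n / ln (real n) * (1 + \<eta>)"
  have b: "?b \<eta> n = (c_upper d * (1 + \<eta>)) * (real n / ln (real n))" for \<eta> n by simp
  \<comment> \<open>Coding failure of the inequality as a null sequence makes the diagonal argument
    cover eventual statements too.\<close>
  have "(\<lambda>n. of_bool (\<not> mean n distinct_fringe \<le> ?b \<eta> n) :: real) \<longlonglongrightarrow> 0" if "\<eta> > 0" for \<eta>
    using upper_bound_rate(2)[of "c_upper d * (1 + \<eta>)"] pos that unfolding b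
    by (intro tendsto_eventually) (auto elim!: eventually_mono)
  then obtain \<delta> where \<delta>: "\<delta> \<longlonglongrightarrow> 0"
    "(\<lambda>n. of_bool (\<not> mean n distinct_fringe \<le> ?b (\<delta> n) n) :: real) \<longlonglongrightarrow> 0"
    using diagonal_null_sequence[of "\<lambda>\<eta> n. of_bool (\<not> mean n distinct_fringe \<le> ?b \<eta> n)"] by blast
  have ev: "\<forall>\<^sub>F n in sequentially. mean n distinct_fringe \<le> ?b (\<delta> n) n"
    using order_tendstoD(2)[OF \<delta>(2), of 1] by (auto elim!: eventually_mono split: if_splits)
  have "(\<lambda>n. mean n (\<lambda>s. of_bool (?b \<eta> n < distinct_fringe s))) \<longlonglongrightarrow> 0" if "\<eta> > 0" for \<eta>
    using upper_bound_rate(1)[of "c_upper d * (1 + \<eta>)"] pos that unfolding b by simp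
  then obtain \<delta>' where "\<delta>' \<longlonglongrightarrow> 0"
    "(\<lambda>n. mean n (\<lambda>s. of_bool (?b (\<delta>' n) n < distinct_fringe s))) \<longlonglongrightarrow> 0"
    using diagonal_null_sequence[of "\<lambda>\<eta> n. mean n (\<lambda>s. of_bool (?b \<eta> n < distinct_fringe s))"] by blast
  then show ?thesis using that \<delta>(1) ev by blast
qed

lemma lower_limits:
  obtains \<epsilon> \<epsilon>' where "\<epsilon> \<longlonglongrightarrow> 0" "\<epsilon>' \<longlonglongrightarrow> 0"
    "\<forall>\<^sub>F n in sequentially. c_lower d * real n / ln (real n) * (1 + \<epsilon> n) \<le> mean n distinct_fringe"
    "(\<lambda>n. mean n (\<lambda>s. of_bool
       (distinct_fringe s < c_lower d * real n / ln (real n) * (1 + \<epsilon>' n)))) \<longlonglongrightarrow> 0"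
proof (cases "0 < c_lower d")
  case pos: True
  let ?b = "\<lambda>\<eta> n. c_lower d * real n / ln (real n) * (1 + - \<eta>)"
  have b: "?b \<eta> n = (c_lower d * (1 + - \<eta>)) * (real n / ln (real n))" for \<eta> n by simp
  have "(\<lambda>n. of_bool (\<not> ?b \<eta> n \<le> mean n distinct_fringe) :: real) \<longlonglongrightarrow> 0" if "\<eta> > 0" for \<eta>
    using lower_bound_rate(2)[OF pos, of "c_lower d * (1 + - \<eta>)"] pos that unfolding b
    by (intro tendsto_eventually) (auto elim!: eventually_mono)
  then obtain \<epsilon> where \<epsilon>: "\<epsilon> \<longlonglongrightarrow> 0"
    "(\<lambda>n. of_bool (\<not> ?b (\<epsilon> n) n \<le> mean n distinct_fringe) :: real) \<longlonglongrightarrow> 0"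
    using diagonal_null_sequence[of "\<lambda>\<eta> n. of_bool (\<not> ?b \<eta> n \<le> mean n distinct_fringe)"] by blast
  have ev: "\<forall>\<^sub>F n in sequentially. ?b (\<epsilon> n) n \<le> mean n distinct_fringe"
    using order_tendstoD(2)[OF \<epsilon>(2), of 1] by (auto elim!: eventually_mono split: if_splits)
  have "(\<lambda>n. mean n (\<lambda>s. of_bool (distinct_fringe s < ?b \<eta> n))) \<longlonglongrightarrow> 0" if "\<eta> > 0" for \<eta>
    using lower_bound_rate(1)[OF pos, of "c_lower d * (1 + - \<eta>)"] pos that unfolding b by simp
  then obtain \<epsilon>' where "\<epsilon>' \<longlonglongrightarrow> 0"
    "(\<lambda>n. mean n (\<lambda>s. of_bool (distinct_fringe s < ?b (\<epsilon>' n) n))) \<longlonglongrightarrow> 0"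
    using diagonal_null_sequence[of "\<lambda>\<eta> n. mean n (\<lambda>s. of_bool (distinct_fringe s < ?b \<eta> n))"] by blast
  then show ?thesis
    using that[of "\<lambda>n. - \<epsilon> n" "\<lambda>n. - \<epsilon>' n"] \<epsilon>(1) ev tendsto_minus[of \<epsilon> 0] tendsto_minus[of \<epsilon>' 0] by simp
next
  case False
  have ln: "0 \<le> ln (real n)" for n by (cases n) auto
  \<comment> \<open>With a nonpositive constant the bound holds trivially with zero error terms, as
    the count is nonnegative.\<close>
  have nonpos: "c_lower d * real n / ln (real n) * (1 + 0) \<le> 0" for n
    using False ln by (simp add: divide_nonpos_nonneg mult_nonpos_nonneg)
  have "c_lower d * real n / ln (real n) * (1 + 0) \<le> distinct_fringe s" for n s
    using nonpos[of n] by (rule order.trans) (simp add: distinct_fringe_def)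
  then have "mean n (\<lambda>s. of_bool (distinct_fringe s < c_lower d * real n / ln (real n) * (1 + 0))) = 0"
    for n by (simp add: not_less[symmetric])
  moreover have "c_lower d * real n / ln (real n) * (1 + 0) \<le> mean n distinct_fringe" for n
    using nonpos[of n] by (rule order.trans) (auto intro: mean_nonneg simp: distinct_fringe_def)
  ultimately show ?thesis
    using that[of "\<lambda>_. 0" "\<lambda>_. 0"] by simp
qed

end

theorem theorem13:
  fixes d :: nat
  assumes "d \<ge> 2"
  shows
    "(\<exists>\<epsilon> \<delta> :: nat \<Rightarrow> real. \<epsilon> \<longlonglongrightarrow> 0 \<and> \<delta> \<longlonglongrightarrow> 0 \<and>
        (\<forall>\<^sub>F n in sequentially.
           c_lower d * real n / ln (real n) * (1 + \<epsilon> n)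
             \<le> measure_pmf.expectation (random_tree d n) (\<lambda>t. real (num_distinct_fringe t)) \<and>
           measure_pmf.expectation (random_tree d n) (\<lambda>t. real (num_distinct_fringe t))
             \<le> c_upper d * real n / ln (real n) * (1 + \<delta> n))) \<and>
     (\<exists>\<epsilon> \<delta> :: nat \<Rightarrow> real. \<epsilon> \<longlonglongrightarrow> 0 \<and> \<delta> \<longlonglongrightarrow> 0 \<and>
        (\<lambda>n. measure_pmf.prob (random_tree d n)
           {t. c_lower d * real n / ln (real n) * (1 + \<epsilon> n) \<le> real (num_distinct_fringe t) \<and>
               real (num_distinct_fringe t) \<le> c_upper d * real n / ln (real n) * (1 + \<delta> n)})
          \<longlonglongrightarrow> 1)"
proof -
  interpret dary_growth d by unfold_locales (rule assms)
  \<comment> \<open>The statistic depends on the shape only, so expectation and probability pass to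
    the growth process.\<close>
  have H: "real (num_distinct_fringe t) = distinct_fringe (shape t)" for t :: "nat dtree"
    by (simp add: num_distinct_fringe_def distinct_fringe_def shape_fringe_subtrees)
  obtain \<epsilon> \<epsilon>' where \<epsilon>: "\<epsilon> \<longlonglongrightarrow> 0" "\<epsilon>' \<longlonglongrightarrow> 0"
    "\<forall>\<^sub>F n in sequentially. c_lower d * real n / ln (real n) * (1 + \<epsilon> n) \<le> mean n distinct_fringe"
    "(\<lambda>n. mean n (\<lambda>s. of_bool
       (distinct_fringe s < c_lower d * real n / ln (real n) * (1 + \<epsilon>' n)))) \<longlonglongrightarrow> 0"
    by (rule lower_limits)
  obtain \<delta> \<delta>' where \<delta>: "\<delta> \<longlonglongrightarrow> 0" "\<delta>' \<longlonglongrightarrow> 0"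
    "\<forall>\<^sub>F n in sequentially. mean n distinct_fringe \<le> c_upper d * real n / ln (real n) * (1 + \<delta> n)"
    "(\<lambda>n. mean n (\<lambda>s. of_bool
       (c_upper d * real n / ln (real n) * (1 + \<delta>' n) < distinct_fringe s))) \<longlonglongrightarrow> 0"
    by (rule upper_limits)
  let ?lo = "\<lambda>n. c_lower d * real n / ln (real n) * (1 + \<epsilon>' n)"
  let ?hi = "\<lambda>n. c_upper d * real n / ln (real n) * (1 + \<delta>' n)"
  have "\<forall>\<^sub>F n in sequentially.
      c_lower d * real n / ln (real n) * (1 + \<epsilon> n)
        \<le> measure_pmf.expectation (random_tree d n) (\<lambda>t. real (num_distinct_fringe t)) \<and>
      measure_pmf.expectation (random_tree d n) (\<lambda>t. real (num_distinct_fringe t))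
        \<le> c_upper d * real n / ln (real n) * (1 + \<delta> n)"
    unfolding H expectation_random_tree using \<epsilon>(3) \<delta>(3) by (rule eventually_conj)
  moreover have "(\<lambda>n. measure_pmf.prob (random_tree d n)
      {t. ?lo n \<le> real (num_distinct_fringe t) \<and> real (num_distinct_fringe t) \<le> ?hi n}) \<longlonglongrightarrow> 1"
    unfolding H prob_random_tree[where P = "\<lambda>s. ?lo _ \<le> distinct_fringe s \<and> distinct_fringe s \<le> ?hi _"]
  proof (rule tendsto_sandwich)
    \<comment> \<open>Union bound over the two exceptional events.\<close>
    have "(\<lambda>n. 1 - (mean n (\<lambda>s. of_bool (distinct_fringe s < ?lo n)) +
        mean n (\<lambda>s. of_bool (?hi n < distinct_fringe s)))) \<longlonglongrightarrow> 1 - (0 + 0)"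
      by (intro tendsto_diff tendsto_add tendsto_const \<epsilon>(4) \<delta>(4))
    then show "(\<lambda>n. 1 - (mean n (\<lambda>s. of_bool (distinct_fringe s < ?lo n)) +
        mean n (\<lambda>s. of_bool (?hi n < distinct_fringe s)))) \<longlonglongrightarrow> 1" by simp
    show "\<forall>\<^sub>F n in sequentially. 1 - (mean n (\<lambda>s. of_bool (distinct_fringe s < ?lo n)) +
        mean n (\<lambda>s. of_bool (?hi n < distinct_fringe s))) \<le>
        mean n (\<lambda>s. of_bool (?lo n \<le> distinct_fringe s \<and> distinct_fringe s \<le> ?hi n))"
    proof (intro always_eventually allI)
      fix n
      have "mean n (\<lambda>s. 1 - (of_bool (distinct_fringe s < ?lo n) + of_bool (?hi n < distinct_fringe s))) \<le>
          mean n (\<lambda>s. of_bool (?lo n \<le> distinct_fringe s \<and> distinct_fringe s \<le> ?hi n))"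
        by (rule mean_mono) auto
      then show "1 - (mean n (\<lambda>s. of_bool (distinct_fringe s < ?lo n)) +
          mean n (\<lambda>s. of_bool (?hi n < distinct_fringe s))) \<le>
          mean n (\<lambda>s. of_bool (?lo n \<le> distinct_fringe s \<and> distinct_fringe s \<le> ?hi n))"
        by (simp only: mean_diff mean_add mean_const)
    qed
    show "\<forall>\<^sub>F n in sequentially.
        mean n (\<lambda>s. of_bool (?lo n \<le> distinct_fringe s \<and> distinct_fringe s \<le> ?hi n)) \<le> 1"
    proof (intro always_eventually allI)
      fix n
      have "mean n (\<lambda>s. of_bool (?lo n \<le> distinct_fringe s \<and> distinct_fringe s \<le> ?hi n)) \<le>
          mean n (\<lambda>_. 1)"
        by (rule mean_mono) auto
      then show "mean n (\<lambda>s. of_bool (?lo n \<le> distinct_fringe s \<and> distinct_fringe s \<le> ?hi n)) \<le> 1"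
        by simp
    qed
  qed simp
  ultimately show ?thesis using \<epsilon>(1,2) \<delta>(1,2) by blast
qed

end
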